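(* Let $(\mathfrak V,\mathfrak V^+,\mathfrak e,|\cdot|)$ be a non-degenerate absolute order unital $\mathfrak F$-bimodule. Let $V=\mathfrak I_1\mathfrak V\mathfrak I_1$, let $T_n:M_n(V)\to\mathfrak V$ be $T_n([v_{i,j}])=\sum_{i,j=1}^n\mathfrak e_{i,1}v_{i,j}\mathfrak e_{1,j}$, let $M_n(V)^+=T_n^{-1}(\mathfrak I_n\mathfrak V^+\mathfrak I_n)$, and let $|v|_n=T_n^{-1}(|T_n(v)|)$ for $v\in M_n(V)$, $n\in\mathbb N$ (the absolutely matrix ordered space corresponding to $(\mathfrak V,\mathfrak V^+,|\cdot|)$). Then $(V,\{M_n(V)^+\},T_1^{-1}(\mathfrak e),\{|\cdot|_n\})$ is an absolute matrix order unit space.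
   Context: **Bimodules.** $\mathfrak F$ is the $*$-algebra of all $\infty\times\infty$ complex matrices with at most finitely many non-zero entries, with conjugate transpose $*$ and operator norm $\|\cdot\|$; $\mathfrak e_{i,j}$ are its matrix units, $\mathfrak I_n=\sum_{i=1}^n\mathfrak e_{i,i}$ and $\mathfrak J_n=\sum_{i=1}^n\mathfrak e_{i,n+i}$. An $\mathfrak F$-bimodule $\mathfrak V$ is non-degenerate if for every $\mathfrak v\in\mathfrak V$ there is $n$ with $\mathfrak I_n\mathfrak v\mathfrak I_n=\mathfrak v$; the least such $n\in\mathbb N$ is the order $o(\mathfrak v)$. It is a complex vector space via $\alpha\mathfrak v=(\alpha\mathfrak I_n)\mathfrak v$ for any such $n$. A $*$-$\mathfrak F$-bimodule has an additive map $*$ with $(\mathfrak a\mathfrak v)^*=\mathfrak v^*\mathfrak a^*$, $(\mathfrak v\mathfrak a)^*=\mathfrak a^*\mathfrak v^*$, $\mathfrak v^{**}=\mathfrak v$; $\mathfrak V_{sa}=\{\mathfrak v:\mathfrak v^*=\mathfrak v\}$. An ordered $\mathfrak F$-bimodule $(\mathfrak V,\mathfrak V^+)$ is a $*$-$\mathfrak F$-bimodule with $\mathfrak V^+\subset\mathfrak V_{sa}$ closed under addition and under $\mathfrak v\mapsto\mathfrak a^*\mathfrak v\mathfrak a$ ($\mathfrak a\in\mathfrak F$); $\mathfrak u\le\mathfrak v$ means $\mathfrak v-\mathfrak u\in\mathfrak V^+$. $\mathfrak V^+$ is proper if $\mathfrak V^+\cap(-\mathfrak V^+)=\{0\}$,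 and Archimedean if whenever $\mathfrak v\in\mathfrak V_{sa}$, $\mathfrak u\in\mathfrak V^+$ and $k\mathfrak u+\mathfrak v\in\mathfrak V^+$ for all real $k>0$, then $\mathfrak v\in\mathfrak V^+$. For $\mathfrak v_1,\mathfrak v_2\in\mathfrak V^+$ and $\mathfrak v\in\mathfrak V$, all fixed by $\mathfrak x\mapsto\mathfrak I_n\mathfrak x\mathfrak I_n$, put $(\mathfrak v_1,\mathfrak v_2)_n^+=\mathfrak v_1+\mathfrak J_n^*\mathfrak v_2\mathfrak J_n$ and $sa_n(\mathfrak v)=\mathfrak I_n\mathfrak v\mathfrak J_n+\mathfrak J_n^*\mathfrak v^*\mathfrak I_n$. Elements $\mathfrak u,\mathfrak v\in\mathfrak V$ are $\mathfrak F$-independent if there are disjoint (finite) $I,J\subset\mathbb N$ with $\mathfrak r\mathfrak u\mathfrak r=\mathfrak u$, $\mathfrak s\mathfrak v\mathfrak s=\mathfrak v$, where $\mathfrak r=\sum_{i\in I}\mathfrak e_{i,i}$, $\mathfrak s=\sum_{j\in J}\mathfrak e_{j,j}$. A *non-degenerate absolutely ordered $\mathfrak F$-bimodule* $(\mathfrak V,\mathfrak V^+,|\cdot|)$ is a non-degenerate ordered $\mathfrak F$-bimodule with a map $|\cdot|:\mathfrak V\to\mathfrak V^+$ such that: (1) $o(|\mathfrak v|)\le o(\mathfrak v)$; (2) $|\mathfrak v|=\mathfrak v$ for $\mathfrak v\in\mathfrak V^+$; (3) $(|\mathfrak v^*|,|\mathfrak v|)^+_{o(\mathfrak v)}+sa_{o(\mathfrak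 v)}(\mathfrak v)\in\mathfrak V^+$ for all $\mathfrak v$; (4) $|\mathfrak a\mathfrak v\mathfrak b|\le\|\mathfrak a\|\,\big||\mathfrak v|\mathfrak b\big|$ for $\mathfrak v\in\mathfrak V$, $\mathfrak a,\mathfrak b\in\mathfrak F$; (5) $|\mathfrak u+\mathfrak v|=|\mathfrak u|+|\mathfrak v|$ for $\mathfrak F$-independent $\mathfrak u,\mathfrak v$; (6) for $\mathfrak u,\mathfrak v,\mathfrak w\in\mathfrak V^+$ with $|\mathfrak u-\mathfrak v|=\mathfrak u+\mathfrak v$ and $0\le\mathfrak w\le\mathfrak v$: $|\mathfrak u-\mathfrak w|=\mathfrak u+\mathfrak w$; (7) for $\mathfrak u,\mathfrak v,\mathfrak w\in\mathfrak V^+$ with $|\mathfrak u-\mathfrak v|=\mathfrak u+\mathfrak v$ and $|\mathfrak u-\mathfrak w|=\mathfrak u+\mathfrak w$: $\big|\mathfrak u-|\mathfrak v\pm\mathfrak w|\big|=\mathfrak u+|\mathfrak v\pm\mathfrak w|$. For $\mathfrak u,\mathfrak v\in\mathfrak V^+$, $\mathfrak u\perp\mathfrak v$ means $|\mathfrak u-\mathfrak v|=\mathfrak u+\mathfrak v$. A *local order unit* for a non-degenerate ordered $\mathfrak F$-bimodule is $\mathfrak e\in\mathfrak V^+$ with $\mathfrak I_1\mathfrak e\mathfrak I_1=\mathfrak e$ such that for each $\mathfrak v\in\mathfrak I_1\mathfrak V\mathfrak I_1$ there is $k>0$ with $(k\mathfrak e,k\mathfrak e)_1^++sa_1(\mathfrak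 v)\in\mathfrak V^+$. If in addition $\mathfrak V^+$ is proper and Archimedean, $(\mathfrak V,\mathfrak V^+,\mathfrak e)$ is a *local $\mathfrak F$-order unit bimodule*; with $\mathfrak e^n:=\sum_{i=1}^n\mathfrak e_{i,1}\mathfrak e\mathfrak e_{1,i}$ it carries the norm $\|\mathfrak v\|=\inf\{k>0:(k\mathfrak e^{o(\mathfrak v)},k\mathfrak e^{o(\mathfrak v)})^+_{o(\mathfrak v)}+sa_{o(\mathfrak v)}(\mathfrak v)\in\mathfrak V^+\}$. For $\mathfrak u,\mathfrak v\in\mathfrak V^+$: $\mathfrak u\perp_\infty\mathfrak v$ means $\|k_1\mathfrak u+k_2\mathfrak v\|=\max\{\|k_1\mathfrak u\|,\|k_2\mathfrak v\|\}$ for all $k_1,k_2\in\mathbb R$; $\mathfrak u\perp_\infty^a\mathfrak v$ means $\mathfrak u_1\perp_\infty\mathfrak v_1$ for all $\mathfrak u_1,\mathfrak v_1\in\mathfrak V^+$ with $\mathfrak u_1\le\mathfrak u$, $\mathfrak v_1\le\mathfrak v$. $(\mathfrak V,\mathfrak V^+,\mathfrak e,|\cdot|)$ is a *non-degenerate absolute order unital $\mathfrak F$-bimodule* if $(\mathfrak V,\mathfrak V^+,\mathfrak e)$ is a local $\mathfrak F$-order unit bimodule, $(\mathfrak V,\mathfrak V^+,|\cdot|)$ is a non-degenerate absolutely ordered $\mathfrak F$-bimodule, and $\perp=\perp_\infty^a$ on $\mathfrak V^+$. **Matrix side.** $M_{m,n}(V)$ denotes $m\times n$ matrices over $V$, $M_{m,n}=M_{m,n}(\mathbb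 C)$, $v\oplus w$ is the block diagonal matrix. A matrix ordered space is a complex vector space $V$ with involution (with $[v_{ij}]^*=[v_{ji}^*]$ on matrices) and cones $M_n(V)^+\subset M_n(V)_{sa}$ such that each $(M_n(V)_{sa},M_n(V)^+)$ is a real ordered vector space and $a^*va\in M_m(V)^+$ for $v\in M_n(V)^+$, $a\in M_{n,m}$. It is a matrix order unit space $(V,\{M_n(V)^+\},e)$ if $e\in V^+$ is an order unit for $V_{sa}$, $V^+$ is proper and every $M_n(V)^+$ is Archimedean; put $e^n=e\oplus\cdots\oplus e\in M_n(V)$ and $\|v\|_n=\inf\left\{k>0:\begin{bmatrix} ke^n & v \\ v^* & ke^n \end{bmatrix}\in M_{2n}(V)^+\right\}$. For $V=\mathfrak I_1\mathfrak V\mathfrak I_1$ as in the claim it is known that $T_n$ is an injective linear map onto $\mathfrak I_n\mathfrak V\mathfrak I_n$ and $(V,\{M_n(V)^+\})$ is a matrix ordered space. An absolutely ordered space $(X,X^+,|\cdot|)$ is a real ordered vector space with $|\cdot|:X\to X^+$ such that: $|v|=v$ for $v\in X^+$; $|v|\pm v\in X^+$; $|kv|=|k||v|$ for $k\in\mathbb R$; if $|u-v|=u+v$ and $0\le w\le v$ then $|u-w|=u+w$; if $|u-v|=u+v$ and $|u-w|=u+w$ then $\big|u-|v\pm w|\big|=u+|v\pm w|$. An absolutely matrix ordered space is a matrix ordered space with maps $|\cdot|_{m,n}:M_{m,n}(V)\to M_n(V)^+$ ($|\cdot|_n:=|\cdot|_{n,n}$) such that: (1) each $(M_n(V)_{sa},M_n(V)^+,|\cdot|_n)$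 is an absolutely ordered space; (2) $|\alpha v\beta|_{r,s}\le\|\alpha\|\,\big||v|_{m,n}\beta\big|_{n,s}$ for $v\in M_{m,n}(V)$, $\alpha\in M_{r,m}$, $\beta\in M_{n,s}$; (3) $|v\oplus w|_{m+r,n+s}=|v|_{m,n}\oplus|w|_{r,s}$. When only the square maps $|\cdot|_n$ are displayed, this means that maps $|\cdot|_{m,n}$ with $|\cdot|_{n,n}=|\cdot|_n$ satisfying (1)–(3) exist; they are forced: $|v|_{m,n}=\left|\begin{bmatrix} v \\ 0 \end{bmatrix}\right|_n$ for $m\le n$, and $|v|_{m,n}\oplus0_{m-n}=\left|\begin{bmatrix} v & 0 \end{bmatrix}\right|_m$ for $m>n$. An *absolute matrix order unit space* is a matrix order unit space that is an absolutely matrix ordered space and for which $\perp=\perp_\infty^a$ on every $M_n(V)^+$, where for $u,v\in M_n(V)^+$: $u\perp v$ means $|u-v|_n=u+v$; $u\perp_\infty v$ means $\|k_1u+k_2v\|_n=\max\{\|k_1u\|_n,\|k_2v\|_n\}$ for all $k_1,k_2\in\mathbb R$; and $u\perp_\infty^a v$ means $u_1\perp_\infty v_1$ for all $u_1,v_1\in M_n(V)^+$ with $u_1\le u$, $v_1\le v$. *)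

theory Defs
  imports "HOL-Analysis.L2_Norm" "Jordan_Normal_Form.Matrix"
begin

section \<open>The algebra of finitely supported infinite matrices\<close>

text \<open>
  Rows and columns are numbered from 0, as in the library type \<^typ>\<open>'a mat\<close>; the matrix unit
  written $e_{1,1}$ in 1-based notation is \<open>unitF 0 0\<close>.
\<close>

typedef finmat = "{a :: nat \<Rightarrow> nat \<Rightarrow> complex. finite {(i, j). a i j \<noteq> 0}}"
  morphisms entry Abs_finmat
  by (intro exI[of _ "\<lambda>_ _. 0"]) simp

setup_lifting type_definition_finmat

lemma finite_cols:
  assumes "finite {(i, j). (a :: nat \<Rightarrow> nat \<Rightarrow> complex) i j \<noteq> 0}"
  shows "finite {j. \<exists>i. a i j \<noteq> 0}"
proof -
  have "{j. \<exists>i. a i j \<noteq> 0} = snd ` {(i, j). a i j \<noteq> 0}" by force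
  then show ?thesis using assms by simp
qed

lemma finite_rows:
  assumes "finite {(i, j). (a :: nat \<Rightarrow> nat \<Rightarrow> complex) i j \<noteq> 0}"
  shows "finite {i. \<exists>j. a i j \<noteq> 0}"
proof -
  have "{i. \<exists>j. a i j \<noteq> 0} = fst ` {(i, j). a i j \<noteq> 0}" by force
  then show ?thesis using assms by simp
qed

instantiation finmat :: ring
begin

lift_definition zero_finmat :: finmat is "\<lambda>_ _. 0" by simp

lift_definition plus_finmat :: "finmat \<Rightarrow> finmat \<Rightarrow> finmat" is "\<lambda>a b i j. a i j + b i j"
proof -
  fix a b :: "nat \<Rightarrow> nat \<Rightarrow> complex"
  assume "finite {(i, j). a i j \<noteq> 0}" "finite {(i, j). b i j \<noteq> 0}"
  then show "finite {(i, j). a i j + b i j \<noteq> 0}"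
    by (rule finite_subset[rotated, OF finite_UnI]) auto
qed

lift_definition uminus_finmat :: "finmat \<Rightarrow> finmat" is "\<lambda>a i j. - a i j" by simp

lift_definition minus_finmat :: "finmat \<Rightarrow> finmat \<Rightarrow> finmat" is "\<lambda>a b i j. a i j - b i j"
proof -
  fix a b :: "nat \<Rightarrow> nat \<Rightarrow> complex"
  assume "finite {(i, j). a i j \<noteq> 0}" "finite {(i, j). b i j \<noteq> 0}"
  then show "finite {(i, j). a i j - b i j \<noteq> 0}"
    by (rule finite_subset[rotated, OF finite_UnI]) auto
qed

lift_definition times_finmat :: "finmat \<Rightarrow> finmat \<Rightarrow> finmat" is
  "\<lambda>a b i k. \<Sum>j | \<exists>i. a i j \<noteq> 0. a i j * b j k"
proof -
  fix a b :: "nat \<Rightarrow> nat \<Rightarrow> complex"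
  assume a: "finite {(i, j). a i j \<noteq> 0}" and b: "finite {(i, j). b i j \<noteq> 0}"
  have "{(i, k). (\<Sum>j | \<exists>i. a i j \<noteq> 0. a i j * b j k) \<noteq> 0}
      \<subseteq> {i. \<exists>j. a i j \<noteq> 0} \<times> {k. \<exists>j. b j k \<noteq> 0}"
  proof (rule subrelI)
    fix i k assume "(i, k) \<in> {(i, k). (\<Sum>j | \<exists>i. a i j \<noteq> 0. a i j * b j k) \<noteq> 0}"
    then obtain j where "a i j * b j k \<noteq> 0" by (auto elim: sum.not_neutral_contains_not_neutral)
    then show "(i, k) \<in> {i. \<exists>j. a i j \<noteq> 0} \<times> {k. \<exists>j. b j k \<noteq> 0}" by auto
  qed
  then show "finite {(i, k). (\<Sum>j | \<exists>i. a i j \<noteq> 0. a i j * b j k) \<noteq> 0}"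
    using finite_rows[OF a] finite_cols[OF b] by (simp add: finite_subset)
qed

instance
proof
  fix a b c :: finmat
  show "a + b + c = a + (b + c)" by transfer (simp add: add.assoc)
  show "a + b = b + a" by transfer (simp add: add.commute)
  show "0 + a = a" by transfer simp
  show "- a + a = 0" by transfer simp
  show "a - b = a + - b" by transfer simp
  show "a * (b + c) = a * b + a * c"
    by transfer (simp add: distrib_left sum.distrib)
  have mult: "entry (x * y) i k = (\<Sum>j\<in>S. entry x i j * entry y j k)"
    if "finite S" "{j. \<exists>i. entry x i j \<noteq> 0} \<subseteq> S" for x y :: finmat and S i k
    using that by transfer (intro sum.mono_neutral_left, auto)
  have fin: "finite {j. \<exists>i. entry x i j \<noteq> 0}" for x :: finmat
    by (rule finite_cols) (use entry[of x] in simp)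
  show "(a + b) * c = a * c + b * c"
  proof -
    let ?S = "{j. \<exists>i. entry a i j \<noteq> 0} \<union> {j. \<exists>i. entry b i j \<noteq> 0}"
    have "finite ?S" by (simp add: fin)
    moreover have "{j. \<exists>i. entry (a + b) i j \<noteq> 0} \<subseteq> ?S"
      by (auto simp: plus_finmat.rep_eq)
    ultimately have "entry ((a + b) * c) i k = entry (a * c + b * c) i k" for i k
      by (simp add: mult[of ?S] plus_finmat.rep_eq distrib_right sum.distrib)
    then show ?thesis by (simp add: entry_inject[symmetric] fun_eq_iff)
  qed
  show "a * b * c = a * (b * c)"
  proof -
    let ?S = "{j. \<exists>i. entry a i j \<noteq> 0}" and ?U = "{j. \<exists>i. entry b i j \<noteq> 0}"
    have "{j. \<exists>i. entry (a * b) i j \<noteq> 0} \<subseteq> ?U"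
    proof clarify
      fix j i assume "entry (a * b) i j \<noteq> 0"
      then obtain l where "entry a i l * entry b l j \<noteq> 0"
        by (metis (no_types, lifting) mult[OF fin order_refl] sum.neutral)
      then show "\<exists>i. entry b i j \<noteq> 0" by auto
    qed
    then have "entry (a * b * c) i k = entry (a * (b * c)) i k" for i k
      by (simp add: mult[of ?U] mult[of ?S] fin sum_distrib_left sum_distrib_right mult.assoc
            sum.swap[of _ ?U])
    then show ?thesis by (simp add: entry_inject[symmetric] fun_eq_iff)
  qed
qed

end

lift_definition scaleF :: "complex \<Rightarrow> finmat \<Rightarrow> finmat" is "\<lambda>z a i j. z * a i j"
  by (rule finite_subset[rotated]) auto

lift_definition adjF :: "finmat \<Rightarrow> finmat" is "\<lambda>a i j. cnj (a j i)"
proof -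
  fix a :: "nat \<Rightarrow> nat \<Rightarrow> complex"
  assume "finite {(i, j). a i j \<noteq> 0}"
  then have "finite (prod.swap ` {(i, j). a i j \<noteq> 0})" by simp
  moreover have "{(i, j). cnj (a j i) \<noteq> 0} \<subseteq> prod.swap ` {(i, j). a i j \<noteq> 0}" by force
  ultimately show "finite {(i, j). cnj (a j i) \<noteq> 0}" by (rule finite_subset[rotated])
qed

text \<open>The operator norm for the action on the finitely supported vectors of $\ell^2$.\<close>

definition normF :: "finmat \<Rightarrow> real" where
  "normF a = Sup {L2_set (\<lambda>i. cmod (\<Sum>j | x j \<noteq> 0. entry a i j * x j)) {i. \<exists>j. entry a i j \<noteq> 0}
     | x :: nat \<Rightarrow> complex. finite {j. x j \<noteq> 0} \<and> L2_set (\<lambda>j. cmod (x j)) {j. x j \<noteq> 0} \<le> 1}"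

lift_definition unitF :: "nat \<Rightarrow> nat \<Rightarrow> finmat" is
  "\<lambda>k l i j. if i = k \<and> j = l then 1 else 0"
  by (rule finite_subset[of _ "{(k, l)}" for k l]) auto

definition diagF :: "nat set \<Rightarrow> finmat" where
  "diagF S = (\<Sum>i\<in>S. unitF i i)"

definition IF :: "nat \<Rightarrow> finmat" where
  "IF n = (\<Sum>i<n. unitF i i)"

definition JF :: "nat \<Rightarrow> finmat" where
  "JF n = (\<Sum>i<n. unitF i (n + i))"


section \<open>Bimodules\<close>

text \<open>
  \<open>balanced\<close> is part of the notion of a bimodule over a complex algebra: complex scalars act in
  the same way from the left and from the right.
\<close>

locale F_bimodule =
  fixes lact :: "finmat \<Rightarrow> 'v::ab_group_add \<Rightarrow> 'v" (infixl \<open>\<triangleright>\<close> 70)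
    and ract :: "'v \<Rightarrow> finmat \<Rightarrow> 'v" (infixl \<open>\<triangleleft>\<close> 70)
  assumes lact_add_left: "(a + b) \<triangleright> v = a \<triangleright> v + b \<triangleright> v"
    and lact_add_right: "a \<triangleright> (u + v) = a \<triangleright> u + a \<triangleright> v"
    and lact_mult: "(a * b) \<triangleright> v = a \<triangleright> (b \<triangleright> v)"
    and ract_add_left: "(u + v) \<triangleleft> a = u \<triangleleft> a + v \<triangleleft> a"
    and ract_add_right: "v \<triangleleft> (a + b) = v \<triangleleft> a + v \<triangleleft> b"
    and ract_mult: "v \<triangleleft> (a * b) = (v \<triangleleft> a) \<triangleleft> b"
    and lact_ract: "(a \<triangleright> v) \<triangleleft> b = a \<triangleright> (v \<triangleleft> b)"
    and balanced: "(scaleF z a \<triangleright> v) \<triangleleft> b = (a \<triangleright> v) \<triangleleft> scaleF z b"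
begin

definition order :: "'v \<Rightarrow> nat" where
  "order v = (LEAST n. n > 0 \<and> IF n \<triangleright> v \<triangleleft> IF n = v)"

definition scale :: "complex \<Rightarrow> 'v \<Rightarrow> 'v" where
  "scale z v = scaleF z (IF (order v)) \<triangleright> v"

abbreviation rscale :: "real \<Rightarrow> 'v \<Rightarrow> 'v" where
  "rscale k \<equiv> scale (complex_of_real k)"

definition independent :: "'v \<Rightarrow> 'v \<Rightarrow> bool" where
  "independent u v \<longleftrightarrow> (\<exists>S T. finite S \<and> finite T \<and> S \<inter> T = {} \<and>
     diagF S \<triangleright> u \<triangleleft> diagF S = u \<and> diagF T \<triangleright> v \<triangleleft> diagF T = v)"

definition pair :: "nat \<Rightarrow> 'v \<Rightarrow> 'v \<Rightarrow> 'v" where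
  "pair n v1 v2 = v1 + adjF (JF n) \<triangleright> v2 \<triangleleft> JF n"

definition amplify :: "nat \<Rightarrow> 'v \<Rightarrow> 'v" where
  "amplify n w = (\<Sum>i<n. unitF i 0 \<triangleright> w \<triangleleft> unitF 0 i)"

definition corner :: "'v set" where
  "corner = range (\<lambda>v. IF 1 \<triangleright> v \<triangleleft> IF 1)"

definition T :: "nat \<Rightarrow> 'v mat \<Rightarrow> 'v" where
  "T n v = (\<Sum>i<n. \<Sum>j<n. unitF i 0 \<triangleright> v $$ (i, j) \<triangleleft> unitF 0 j)"

end

locale star_F_bimodule = F_bimodule lact ract
  for lact :: "finmat \<Rightarrow> 'v::ab_group_add \<Rightarrow> 'v" (infixl \<open>\<triangleright>\<close> 70)
    and ract :: "'v \<Rightarrow> finmat \<Rightarrow> 'v" (infixl \<open>\<triangleleft>\<close> 70) +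
  fixes star :: "'v \<Rightarrow> 'v"
  assumes star_add: "star (u + v) = star u + star v"
    and star_lact: "star (a \<triangleright> v) = star v \<triangleleft> adjF a"
    and star_ract: "star (v \<triangleleft> a) = adjF a \<triangleright> star v"
    and star_star: "star (star v) = v"
begin

definition sa :: "nat \<Rightarrow> 'v \<Rightarrow> 'v" where
  "sa n v = IF n \<triangleright> v \<triangleleft> JF n + adjF (JF n) \<triangleright> star v \<triangleleft> IF n"

end

locale nondegenerate_ordered_F_bimodule = star_F_bimodule lact ract star
  for lact :: "finmat \<Rightarrow> 'v::ab_group_add \<Rightarrow> 'v" (infixl \<open>\<triangleright>\<close> 70)
    and ract :: "'v \<Rightarrow> finmat \<Rightarrow> 'v" (infixl \<open>\<triangleleft>\<close> 70)
    and star :: "'v \<Rightarrow> 'v" +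
  fixes Pos :: "'v set"
  assumes nondegenerate: "\<exists>n>0. IF n \<triangleright> v \<triangleleft> IF n = v"
    and Pos_sa: "v \<in> Pos \<Longrightarrow> star v = v"
    and Pos_add: "u \<in> Pos \<Longrightarrow> v \<in> Pos \<Longrightarrow> u + v \<in> Pos"
    and Pos_conj: "v \<in> Pos \<Longrightarrow> adjF a \<triangleright> v \<triangleleft> a \<in> Pos"
begin

definition le :: "'v \<Rightarrow> 'v \<Rightarrow> bool" (infix \<open>\<preceq>\<close> 50) where
  "u \<preceq> v \<longleftrightarrow> v - u \<in> Pos"

end

locale nondegenerate_absolutely_ordered_F_bimodule =
  nondegenerate_ordered_F_bimodule lact ract star Pos
  for lact :: "finmat \<Rightarrow> 'v::ab_group_add \<Rightarrow> 'v" (infixl \<open>\<triangleright>\<close> 70)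
    and ract :: "'v \<Rightarrow> finmat \<Rightarrow> 'v" (infixl \<open>\<triangleleft>\<close> 70)
    and star :: "'v \<Rightarrow> 'v"
    and Pos :: "'v set" +
  fixes absv :: "'v \<Rightarrow> 'v"
  assumes absv_Pos: "absv v \<in> Pos"
    and order_absv: "order (absv v) \<le> order v"
    and absv_of_Pos: "v \<in> Pos \<Longrightarrow> absv v = v"
    and absv_sa: "pair (order v) (absv (star v)) (absv v) + sa (order v) v \<in> Pos"
    and absv_act: "absv (a \<triangleright> v \<triangleleft> b) \<preceq> rscale (normF a) (absv (absv v \<triangleleft> b))"
    and absv_independent: "independent u v \<Longrightarrow> absv (u + v) = absv u + absv v"
    and absv_orth_le: "\<lbrakk>u \<in> Pos; v \<in> Pos; w \<in> Pos; absv (u - v) = u + v; w \<preceq> v\<rbrakk>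
          \<Longrightarrow> absv (u - w) = u + w"
    and absv_orth_add: "\<lbrakk>u \<in> Pos; v \<in> Pos; w \<in> Pos; absv (u - v) = u + v; absv (u - w) = u + w\<rbrakk>
          \<Longrightarrow> absv (u - absv (v + w)) = u + absv (v + w)"
    and absv_orth_diff: "\<lbrakk>u \<in> Pos; v \<in> Pos; w \<in> Pos; absv (u - v) = u + v; absv (u - w) = u + w\<rbrakk>
          \<Longrightarrow> absv (u - absv (v - w)) = u + absv (v - w)"
begin

definition perp :: "'v \<Rightarrow> 'v \<Rightarrow> bool" where
  "perp u v \<longleftrightarrow> absv (u - v) = u + v"

end

locale local_F_order_unit_bimodule =
  nondegenerate_ordered_F_bimodule lact ract star Pos
  for lact :: "finmat \<Rightarrow> 'v::ab_group_add \<Rightarrow> 'v" (infixl \<open>\<triangleright>\<close> 70)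
    and ract :: "'v \<Rightarrow> finmat \<Rightarrow> 'v" (infixl \<open>\<triangleleft>\<close> 70)
    and star :: "'v \<Rightarrow> 'v"
    and Pos :: "'v set" +
  fixes e :: 'v
  assumes unit_Pos: "e \<in> Pos"
    and unit_corner: "IF 1 \<triangleright> e \<triangleleft> IF 1 = e"
    and local_order_unit:
      "v \<in> corner \<Longrightarrow> \<exists>k>0. pair 1 (rscale k e) (rscale k e) + sa 1 v \<in> Pos"
    and proper: "Pos \<inter> uminus ` Pos = {0}"
    and archimedean: "\<lbrakk>star v = v; u \<in> Pos; \<And>k. k > 0 \<Longrightarrow> rscale k u + v \<in> Pos\<rbrakk> \<Longrightarrow> v \<in> Pos"
begin

definition normV :: "'v \<Rightarrow> real" where
  "normV v = Inf {k. k > 0 \<and>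
     pair (order v) (rscale k (amplify (order v) e)) (rscale k (amplify (order v) e))
       + sa (order v) v \<in> Pos}"

definition perp_inf :: "'v \<Rightarrow> 'v \<Rightarrow> bool" where
  "perp_inf u v \<longleftrightarrow> (\<forall>k1 k2 :: real.
     normV (rscale k1 u + rscale k2 v) = max (normV (rscale k1 u)) (normV (rscale k2 v)))"

definition perp_inf_a :: "'v \<Rightarrow> 'v \<Rightarrow> bool" where
  "perp_inf_a u v \<longleftrightarrow> (\<forall>u1\<in>Pos. \<forall>v1\<in>Pos. u1 \<preceq> u \<longrightarrow> v1 \<preceq> v \<longrightarrow> perp_inf u1 v1)"

end

locale nondegenerate_absolute_order_unital_F_bimodule =
  nondegenerate_absolutely_ordered_F_bimodule lact ract star Pos absv +
  local_F_order_unit_bimodule lact ract star Pos e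
  for lact :: "finmat \<Rightarrow> 'v::ab_group_add \<Rightarrow> 'v" (infixl \<open>\<triangleright>\<close> 70)
    and ract :: "'v \<Rightarrow> finmat \<Rightarrow> 'v" (infixl \<open>\<triangleleft>\<close> 70)
    and star :: "'v \<Rightarrow> 'v"
    and Pos :: "'v set"
    and e :: 'v
    and absv :: "'v \<Rightarrow> 'v" +
  assumes perp_iff: "u \<in> Pos \<Longrightarrow> v \<in> Pos \<Longrightarrow> perp u v \<longleftrightarrow> perp_inf_a u v"


section \<open>Ordered vector spaces with an explicit carrier\<close>

text \<open>
  The carrier and the zero vector are parameters so that the same locale covers a subspace of a type
  and the matrices of a fixed format in \<^typ>\<open>'a mat\<close>, where zero depends on the format.
\<close>

locale vector_space_on =
  fixes X :: "'x::{plus, minus, uminus} set"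
    and zero :: 'x
    and scale :: "'k::field \<Rightarrow> 'x \<Rightarrow> 'x"
  assumes zero_mem: "zero \<in> X"
    and add_mem: "\<lbrakk>x \<in> X; y \<in> X\<rbrakk> \<Longrightarrow> x + y \<in> X"
    and uminus_mem: "x \<in> X \<Longrightarrow> - x \<in> X"
    and scale_mem: "x \<in> X \<Longrightarrow> scale k x \<in> X"
    and add_assoc: "\<lbrakk>x \<in> X; y \<in> X; z \<in> X\<rbrakk> \<Longrightarrow> (x + y) + z = x + (y + z)"
    and add_commute: "\<lbrakk>x \<in> X; y \<in> X\<rbrakk> \<Longrightarrow> x + y = y + x"
    and zero_add: "x \<in> X \<Longrightarrow> zero + x = x"
    and add_uminus: "x \<in> X \<Longrightarrow> x + (- x) = zero"
    and minus_eq: "\<lbrakk>x \<in> X; y \<in> X\<rbrakk> \<Longrightarrow> x - y = x + (- y)"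
    and scale_add_right: "\<lbrakk>x \<in> X; y \<in> X\<rbrakk> \<Longrightarrow> scale k (x + y) = scale k x + scale k y"
    and scale_add_left: "x \<in> X \<Longrightarrow> scale (k + l) x = scale k x + scale l x"
    and scale_scale: "x \<in> X \<Longrightarrow> scale k (scale l x) = scale (k * l) x"
    and scale_one: "x \<in> X \<Longrightarrow> scale 1 x = x"

locale real_ordered_vector_space = vector_space_on X zero scale
  for X :: "'x::{plus, minus, uminus} set"
    and zero :: 'x
    and scale :: "real \<Rightarrow> 'x \<Rightarrow> 'x" +
  fixes P :: "'x set"
  assumes cone_subset: "P \<subseteq> X"
    and cone_zero: "zero \<in> P"
    and cone_add: "\<lbrakk>x \<in> P; y \<in> P\<rbrakk> \<Longrightarrow> x + y \<in> P"
    and cone_scale: "\<lbrakk>x \<in> P; k \<ge> 0\<rbrakk> \<Longrightarrow> scale k x \<in> P"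

locale absolutely_ordered_space = real_ordered_vector_space X zero scale P
  for X :: "'x::{plus, minus, uminus} set"
    and zero :: 'x
    and scale :: "real \<Rightarrow> 'x \<Rightarrow> 'x"
    and P :: "'x set" +
  fixes absx :: "'x \<Rightarrow> 'x"
  assumes abs_mem: "v \<in> X \<Longrightarrow> absx v \<in> P"
    and abs_of_cone: "v \<in> P \<Longrightarrow> absx v = v"
    and abs_plus: "v \<in> X \<Longrightarrow> absx v + v \<in> P"
    and abs_minus: "v \<in> X \<Longrightarrow> absx v - v \<in> P"
    and abs_scale: "v \<in> X \<Longrightarrow> absx (scale k v) = scale \<bar>k\<bar> (absx v)"
    and abs_orth_le: "\<lbrakk>u \<in> X; v \<in> X; w \<in> X; absx (u - v) = u + v; w \<in> P; v - w \<in> P\<rbrakk>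
          \<Longrightarrow> absx (u - w) = u + w"
    and abs_orth_add: "\<lbrakk>u \<in> X; v \<in> X; w \<in> X; absx (u - v) = u + v; absx (u - w) = u + w\<rbrakk>
          \<Longrightarrow> absx (u - absx (v + w)) = u + absx (v + w)"
    and abs_orth_diff: "\<lbrakk>u \<in> X; v \<in> X; w \<in> X; absx (u - v) = u + v; absx (u - w) = u + w\<rbrakk>
          \<Longrightarrow> absx (u - absx (v - w)) = u + absx (v - w)"


section \<open>Matrix ordered spaces\<close>

text \<open>
  The adjoint is spelled out because the constant \<open>mat_adjoint\<close> of \<open>Jordan_Normal_Form\<close>
  is the adjoint only for square matrices.
\<close>

definition cadjoint :: "complex mat \<Rightarrow> complex mat" where
  "cadjoint a = map_mat cnj (transpose_mat a)"

definition opnorm :: "complex mat \<Rightarrow> real" where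
  "opnorm a = Sup {L2_set (\<lambda>i. cmod ((a *\<^sub>v x) $ i)) {..<dim_row a} | x.
     x \<in> carrier_vec (dim_col a) \<and> L2_set (\<lambda>j. cmod (x $ j)) {..<dim_col a} \<le> 1}"

locale star_vector_space = vector_space_on V 0 scale
  for V :: "'v::ab_group_add set"
    and scale :: "complex \<Rightarrow> 'v \<Rightarrow> 'v" +
  fixes star :: "'v \<Rightarrow> 'v"
  assumes star_mem: "v \<in> V \<Longrightarrow> star v \<in> V"
    and star_add: "\<lbrakk>u \<in> V; v \<in> V\<rbrakk> \<Longrightarrow> star (u + v) = star u + star v"
    and star_scale: "v \<in> V \<Longrightarrow> star (scale z v) = scale (cnj z) (star v)"
    and star_star: "v \<in> V \<Longrightarrow> star (star v) = v"
begin

definition M :: "nat \<Rightarrow> nat \<Rightarrow> 'v mat set" where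
  "M m n = {v \<in> carrier_mat m n. elements_mat v \<subseteq> V}"

definition adj :: "'v mat \<Rightarrow> 'v mat" where
  "adj v = map_mat star (transpose_mat v)"

definition M_sa :: "nat \<Rightarrow> 'v mat set" where
  "M_sa n = {v \<in> M n n. adj v = v}"

definition mscale :: "real \<Rightarrow> 'v mat \<Rightarrow> 'v mat" where
  "mscale k v = map_mat (scale (complex_of_real k)) v"

definition lmul :: "complex mat \<Rightarrow> 'v mat \<Rightarrow> 'v mat" where
  "lmul a v = mat (dim_row a) (dim_col v)
     (\<lambda>(i, j). \<Sum>k<dim_row v. scale (a $$ (i, k)) (v $$ (k, j)))"

definition rmul :: "'v mat \<Rightarrow> complex mat \<Rightarrow> 'v mat" where
  "rmul v b = mat (dim_row v) (dim_col b)
     (\<lambda>(i, j). \<Sum>k<dim_col v. scale (b $$ (k, j)) (v $$ (i, k)))"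

definition dsum :: "'v mat \<Rightarrow> 'v mat \<Rightarrow> 'v mat" where
  "dsum v w = four_block_mat v (0\<^sub>m (dim_row v) (dim_col w)) (0\<^sub>m (dim_row w) (dim_col v)) w"

end

locale matrix_ordered_space = star_vector_space V scale star
  for V :: "'v::ab_group_add set"
    and scale :: "complex \<Rightarrow> 'v \<Rightarrow> 'v"
    and star :: "'v \<Rightarrow> 'v" +
  fixes P :: "nat \<Rightarrow> 'v mat set"
  assumes ordered_level:
      "n > 0 \<Longrightarrow> real_ordered_vector_space (M_sa n) (0\<^sub>m n n) mscale (P n)"
    and cone_conj: "\<lbrakk>m > 0; n > 0; v \<in> P n; a \<in> carrier_mat n m\<rbrakk>
          \<Longrightarrow> rmul (lmul (cadjoint a) v) a \<in> P m"
begin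

text \<open>$V^+$ and $V_{sa}$ are the first levels under the identification of $M_1(V)$ with $V$.\<close>

definition V_pos :: "'v set" where
  "V_pos = {v \<in> V. mat 1 1 (\<lambda>_. v) \<in> P 1}"

definition V_sa :: "'v set" where
  "V_sa = {v \<in> V. star v = v}"

end

locale matrix_order_unit_space = matrix_ordered_space V scale star P
  for V :: "'v::ab_group_add set"
    and scale :: "complex \<Rightarrow> 'v \<Rightarrow> 'v"
    and star :: "'v \<Rightarrow> 'v"
    and P :: "nat \<Rightarrow> 'v mat set" +
  fixes e :: 'v
  assumes unit_pos: "e \<in> V_pos"
    and order_unit: "v \<in> V_sa \<Longrightarrow>
          \<exists>k>0. scale (complex_of_real k) e + v \<in> V_pos \<and> scale (complex_of_real k) e - v \<in> V_pos"
    and proper: "V_pos \<inter> uminus ` V_pos = {0}"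
    and archimedean: "\<lbrakk>n > 0; x \<in> M_sa n; u \<in> P n; \<And>k. k > 0 \<Longrightarrow> mscale k u + x \<in> P n\<rbrakk>
          \<Longrightarrow> x \<in> P n"
begin

definition unit_mat :: "nat \<Rightarrow> 'v mat" where
  "unit_mat n = mat n n (\<lambda>(i, j). if i = j then e else 0)"

definition mnorm :: "nat \<Rightarrow> 'v mat \<Rightarrow> real" where
  "mnorm n v = Inf {k. k > 0 \<and>
     four_block_mat (mscale k (unit_mat n)) v (adj v) (mscale k (unit_mat n)) \<in> P (2 * n)}"

definition mperp_inf :: "nat \<Rightarrow> 'v mat \<Rightarrow> 'v mat \<Rightarrow> bool" where
  "mperp_inf n u v \<longleftrightarrow> (\<forall>k1 k2 :: real.
     mnorm n (mscale k1 u + mscale k2 v) = max (mnorm n (mscale k1 u)) (mnorm n (mscale k2 v)))"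

definition mperp_inf_a :: "nat \<Rightarrow> 'v mat \<Rightarrow> 'v mat \<Rightarrow> bool" where
  "mperp_inf_a n u v \<longleftrightarrow> (\<forall>u1\<in>P n. \<forall>v1\<in>P n. u - u1 \<in> P n \<longrightarrow> v - v1 \<in> P n \<longrightarrow> mperp_inf n u1 v1)"

end

locale absolutely_matrix_ordered_space = matrix_ordered_space V scale star P
  for V :: "'v::ab_group_add set"
    and scale :: "complex \<Rightarrow> 'v \<Rightarrow> 'v"
    and star :: "'v \<Rightarrow> 'v"
    and P :: "nat \<Rightarrow> 'v mat set" +
  fixes absm :: "nat \<Rightarrow> nat \<Rightarrow> 'v mat \<Rightarrow> 'v mat"
  assumes absm_mem: "\<lbrakk>m > 0; n > 0; v \<in> M m n\<rbrakk> \<Longrightarrow> absm m n v \<in> P n"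
    and absm_level: "n > 0 \<Longrightarrow>
          absolutely_ordered_space (M_sa n) (0\<^sub>m n n) mscale (P n) (absm n n)"
    and absm_mul: "\<lbrakk>m > 0; n > 0; r > 0; s > 0;
          v \<in> M m n; a \<in> carrier_mat r m; b \<in> carrier_mat n s\<rbrakk> \<Longrightarrow>
          mscale (opnorm a) (absm n s (rmul (absm m n v) b)) - absm r s (rmul (lmul a v) b) \<in> P s"
    and absm_dsum: "\<lbrakk>m > 0; n > 0; r > 0; s > 0; v \<in> M m n; w \<in> M r s\<rbrakk> \<Longrightarrow>
          absm (m + r) (n + s) (dsum v w) = dsum (absm m n v) (absm r s w)"
begin

definition mperp :: "nat \<Rightarrow> 'v mat \<Rightarrow> 'v mat \<Rightarrow> bool" where
  "mperp n u v \<longleftrightarrow> absm n n (u - v) = u + v"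

end

locale absolute_matrix_order_unit_space =
  matrix_order_unit_space V scale star P e + absolutely_matrix_ordered_space V scale star P absm
  for V :: "'v::ab_group_add set"
    and scale :: "complex \<Rightarrow> 'v \<Rightarrow> 'v"
    and star :: "'v \<Rightarrow> 'v"
    and P :: "nat \<Rightarrow> 'v mat set"
    and e :: 'v
    and absm :: "nat \<Rightarrow> nat \<Rightarrow> 'v mat \<Rightarrow> 'v mat" +
  assumes mperp_iff: "\<lbrakk>n > 0; u \<in> P n; v \<in> P n\<rbrakk> \<Longrightarrow> mperp n u v \<longleftrightarrow> mperp_inf_a n u v"

end

theory Submission
  imports Defs
begin

text \<open>
  The map $T_n$ identifies $M_n(V)$ with $I_n \mathfrak{V} I_n$ and turns products with scalar
  matrices, block matrices and adjoints into the module operations, so most axioms are transported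
  along it. Three points need an argument.

  First, $|v|$ has to stay inside $I_n \mathfrak{V} I_n$ when $v = v I_n$ is a rectangular element
  with many rows; this holds because $|v| \le b\,|v|\,b$ for every diagonal symmetry $b$ with
  $v b = v$. The same estimate shows $|v b| = b^* |v| b$ for partial isometries $b$ with
  $v b b^* = v$, which together with $|a v| = |v|$ for isometries $a$ reduces the absolute value of
  a direct sum to that of an $\mathfrak{F}$-independent pair.

  Second, the norm of $\mathfrak{V}$ uses the order $o(v)$ instead of $n$; compressing and dilating
  the $2 \times 2$ blocks by $I_m + J_n^* J_m$ and $I_m + J_m^* J_n$ shows that nothing depends on
  this choice.

  Third, $0 \le u \le w$ with $w \in I_n \mathfrak{V} I_n$ forces $u \in I_n \mathfrak{V} I_n$ (by
  the Archimedean property), so that $\perp_\infty^a$ has the same meaning on both sides.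
\<close>

section \<open>The algebra of finite matrices\<close>

lemma finmat_eqI: "(\<And>i j. entry a i j = entry b i j) \<Longrightarrow> a = b"
  by (simp add: entry_inject[symmetric] fun_eq_iff)

lemma finite_support: "finite {(i, j). entry a i j \<noteq> 0}"
  using entry[of a] by simp

text \<open>The defining sum runs over the nonzero columns of the left factor only. Enlarging the
  index set adds zero terms, so that products with different left factors can be compared over one
  set.\<close>

lemma entry_times:
  assumes "finite S" "{j. \<exists>i. entry a i j \<noteq> 0} \<subseteq> S"
  shows "entry (a * b) i k = (\<Sum>j\<in>S. entry a i j * entry b j k)"
  using assms by transfer (intro sum.mono_neutral_left, auto)

lemmas entry_simps [simp] = zero_finmat.rep_eq plus_finmat.rep_eq uminus_finmat.rep_eq
  minus_finmat.rep_eq scaleF.rep_eq adjF.rep_eq unitF.rep_eq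

lemma entry_sum [simp]: "entry (sum f S) i j = (\<Sum>k\<in>S. entry (f k) i j)"
  by (induction S rule: infinite_finite_induct) auto

lemma entry_unitF_times [simp]: "entry (unitF k l * a) i j = (if i = k then entry a l j else 0)"
  by (subst entry_times[of "{l}"]) auto

lemma entry_scaleF_times [simp]: "entry (scaleF z a * b) i j = z * entry (a * b) i j"
proof -
  have fin: "finite {j. \<exists>i. entry a i j \<noteq> 0}"
    by (rule finite_cols) (rule finite_support)
  show ?thesis
    using fin by (subst (1 2) entry_times[OF fin]) (auto simp: sum_distrib_left mult.assoc)
qed

lemma entry_times_scaleF [simp]: "entry (a * scaleF z b) i j = z * entry (a * b) i j"
proof -
  have fin: "finite {j. \<exists>i. entry a i j \<noteq> 0}"
    by (rule finite_cols) (rule finite_support)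
  show ?thesis
    using fin by (subst (1 2) entry_times[OF fin]) (auto simp: sum_distrib_left mult.left_commute)
qed

lemma adjF_simps [simp]:
  "adjF (adjF a) = a" "adjF (a + b) = adjF a + adjF b" "adjF (a - b) = adjF a - adjF b"
  "adjF (- a) = - adjF a" "adjF (unitF i j) = unitF j i" "adjF 0 = 0"
  "adjF (scaleF z a) = scaleF (cnj z) (adjF a)"
  by (auto intro!: finmat_eqI)

lemma adjF_sum [simp]: "adjF (sum f S) = (\<Sum>k\<in>S. adjF (f k))"
  by (auto intro!: finmat_eqI)

lemma adjF_times [simp]: "adjF (a * b) = adjF b * adjF a"
proof (rule finmat_eqI)
  fix i k
  let ?S = "{j. \<exists>i. entry a i j \<noteq> 0} \<union> {i. \<exists>j. entry b i j \<noteq> 0}"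
  have fin: "finite ?S"
    using finite_cols[OF finite_support] finite_rows[OF finite_support] by auto
  have "entry (a * b) k i = (\<Sum>j\<in>?S. entry a k j * entry b j i)"
    by (rule entry_times[OF fin]) auto
  moreover have "entry (adjF b * adjF a) i k
      = (\<Sum>j\<in>?S. entry (adjF b) i j * entry (adjF a) j k)"
    by (rule entry_times[OF fin]) auto
  ultimately show "entry (adjF (a * b)) i k = entry (adjF b * adjF a) i k"
    by (simp add: mult.commute)
qed

text \<open>Taking adjoints swaps the factors, so each entry rule for left multiplication yields the
  one for right multiplication.\<close>

lemma entry_times_adjF: "entry (a * b) i j = cnj (entry (adjF b * adjF a) j i)"
  by (metis adjF.rep_eq adjF_times complex_cnj_cnj)

lemma entry_times_unitF [simp]: "entry (a * unitF k l) i j = (if j = l then entry a i k else 0)"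
  by (subst entry_times_adjF) simp

section \<open>Diagonal projections and shifts\<close>

lemma entry_diagF: "finite S \<Longrightarrow> entry (diagF S) i j = (if i = j \<and> i \<in> S then 1 else 0)"
proof -
  assume "finite S"
  have "entry (diagF S) i j = (\<Sum>k\<in>S. if k = i then (if i = j then 1 else 0) else 0)"
    unfolding diagF_def entry_sum by (rule sum.cong) auto
  then show ?thesis using \<open>finite S\<close> by simp
qed

lemma entry_diagF_times [simp]:
  assumes "finite S"
  shows "entry (diagF S * a) i j = (if i \<in> S then entry a i j else 0)"
  using assms unfolding diagF_def by (simp add: sum_distrib_right)

lemma adjF_diagF [simp]: "adjF (diagF S) = diagF S"
  by (simp add: diagF_def)

lemma entry_times_diagF [simp]:
  "finite S \<Longrightarrow> entry (a * diagF S) i j = (if j \<in> S then entry a i j else 0)"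
  by (subst entry_times_adjF) simp

lemma IF_eq_diagF: "IF n = diagF {..<n}"
  by (simp add: IF_def diagF_def)

text \<open>The partial isometry taking coordinates \<open>m, ..., m + r - 1\<close> to
  \<open>0, ..., r - 1\<close>. \<open>JF n\<close> is the case \<open>m = r = n\<close>; a free
  offset is needed to place rectangular blocks.\<close>

definition shiftF :: "nat \<Rightarrow> nat \<Rightarrow> finmat" where
  "shiftF m r = (\<Sum>i<r. unitF i (m + i))"

lemma JF_eq_shiftF: "JF n = shiftF n n"
  by (simp add: JF_def shiftF_def)

lemma entry_shiftF_times [simp]:
  "entry (shiftF m r * a) i j = (if i < r then entry a (m + i) j else 0)"
  unfolding shiftF_def by (simp add: sum_distrib_right)

lemma entry_adjF_shiftF_times [simp]:
  "entry (adjF (shiftF m r) * a) i j = (if m \<le> i \<and> i < m + r then entry a (i - m) j else 0)"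
proof -
  have "entry (adjF (shiftF m r) * a) i j = (\<Sum>k<r. if i = m + k then entry a k j else 0)"
    unfolding shiftF_def by (simp add: sum_distrib_right)
  also have "\<dots> = (\<Sum>k<r. if k = i - m then (if m \<le> i then entry a k j else 0) else 0)"
    by (rule sum.cong) auto
  finally show ?thesis by auto
qed

lemma entry_times_shiftF [simp]:
  "entry (a * shiftF m r) i j = (if m \<le> j \<and> j < m + r then entry a i (j - m) else 0)"
  by (subst entry_times_adjF) simp

lemma entry_times_adjF_shiftF [simp]:
  "entry (a * adjF (shiftF m r)) i j = (if j < r then entry a i (m + j) else 0)"
  by (subst entry_times_adjF) simp

lemma entry_shiftF [simp]: "entry (shiftF m r) i j = (if i < r \<and> j = m + i then 1 else 0)"
proof -
  have "entry (shiftF m r) i j = (\<Sum>k<r. if k = i then (if j = m + i then 1 else 0) else 0)"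
    unfolding shiftF_def entry_sum by (rule sum.cong) auto
  then show ?thesis by simp
qed

lemma unitF_times_unitF: "unitF i j * unitF k l = (if j = k then unitF i l else 0)"
  by (auto intro!: finmat_eqI)

lemma diagF_times_diagF: "finite S \<Longrightarrow> finite S' \<Longrightarrow> diagF S * diagF S' = diagF (S \<inter> S')"
  by (auto intro!: finmat_eqI simp: entry_diagF)

lemma shiftF_times_adjF_shiftF: "shiftF m r * adjF (shiftF m r) = diagF {..<r}"
  by (auto intro!: finmat_eqI simp: entry_diagF)

lemma adjF_shiftF_times_shiftF: "adjF (shiftF m r) * shiftF m r = diagF {m..<m + r}"
  by (auto intro!: finmat_eqI simp: entry_diagF)

text \<open>Provides local units by finiteness of the support. They turn \<open>scaleF z a\<close>
  into the scalar action followed by \<open>a\<close>.\<close>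

lemma IF_absorbing: "\<exists>N. \<forall>n\<ge>N. IF n * a = a \<and> a * IF n = a"
proof -
  have "finite ({i. \<exists>j. entry a i j \<noteq> 0} \<union> {j. \<exists>i. entry a i j \<noteq> 0})"
    using finite_cols[OF finite_support] finite_rows[OF finite_support] by auto
  then obtain N where "{i. \<exists>j. entry a i j \<noteq> 0} \<union> {j. \<exists>i. entry a i j \<noteq> 0} \<subseteq> {..<N}"
    unfolding finite_nat_set_iff_bounded by blast
  then have *: "entry a i j = 0" if "i \<ge> N \<or> j \<ge> N" for i j
    using that by force
  have "IF n * a = a" "a * IF n = a" if "n \<ge> N" for n
    using that * by (auto intro!: finmat_eqI simp: IF_eq_diagF)
  then show ?thesis by blast
qed

text \<open>The hypothesis makes \<open>a\<close> a partial isometry with initial projection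
  \<open>diagF S\<close>, so the squared length of \<open>a x\<close> is the part of the squared
  length of \<open>x\<close> coming from indices in \<open>S\<close>. All contractions in the later
  estimates are recognized in this way.\<close>

lemma normF_le_one:
  assumes "finite S" and a: "adjF a * a = diagF S"
  shows "normF a \<le> 1"
  unfolding normF_def
proof (rule cSup_least)
  show "{L2_set (\<lambda>i. cmod (\<Sum>j | x j \<noteq> 0. entry a i j * x j)) {i. \<exists>j. entry a i j \<noteq> 0} | x.
      finite {j. x j \<noteq> 0} \<and> L2_set (\<lambda>j. cmod (x j)) {j. x j \<noteq> 0} \<le> 1} \<noteq> {}"
    by (auto intro!: exI[of _ "\<lambda>_. 0"])
next
  fix y
  assume "y \<in> {L2_set (\<lambda>i. cmod (\<Sum>j | x j \<noteq> 0. entry a i j * x j)) {i. \<exists>j. entry a i j \<noteq> 0} | x.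
      finite {j. x j \<noteq> 0} \<and> L2_set (\<lambda>j. cmod (x j)) {j. x j \<noteq> 0} \<le> 1}"
  then obtain x where fx: "finite {j. x j \<noteq> 0}"
    and x: "L2_set (\<lambda>j. cmod (x j)) {j. x j \<noteq> 0} \<le> 1"
    and y: "y = L2_set (\<lambda>i. cmod (\<Sum>j | x j \<noteq> 0. entry a i j * x j)) {i. \<exists>j. entry a i j \<noteq> 0}"
    by blast
  let ?X = "{j. x j \<noteq> 0}" and ?R = "{i. \<exists>j. entry a i j \<noteq> 0}"
  have fR: "finite ?R" by (rule finite_rows) (rule finite_support)
  \<comment> \<open>The columns of \<open>a\<close> with index in \<open>S\<close> are orthonormal,
    the others vanish.\<close>
  have gram: "(\<Sum>i\<in>?R. cnj (entry a i k) * entry a i j) = (if k = j \<and> k \<in> S then 1 else 0)" for j k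
  proof -
    have "entry (adjF a * a) k j = (\<Sum>i\<in>?R. entry (adjF a) k i * entry a i j)"
      by (rule entry_times[OF fR]) auto
    then show ?thesis using entry_diagF[OF \<open>finite S\<close>] by (simp add: a)
  qed
  have "complex_of_real (\<Sum>i\<in>?R. (cmod (\<Sum>j\<in>?X. entry a i j * x j))\<^sup>2)
      = (\<Sum>i\<in>?R. (\<Sum>j\<in>?X. entry a i j * x j) * (\<Sum>k\<in>?X. cnj (entry a i k * x k)))"
    by (simp only: of_real_sum complex_norm_square cnj_sum)
  also have "\<dots> = (\<Sum>i\<in>?R. \<Sum>j\<in>?X. \<Sum>k\<in>?X. x j * cnj (x k) * (cnj (entry a i k) * entry a i j))"
    by (simp add: sum_product mult_ac)
  also have "\<dots> = (\<Sum>j\<in>?X. \<Sum>k\<in>?X. x j * cnj (x k) * (\<Sum>i\<in>?R. cnj (entry a i k) * entry a i j))"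
    unfolding sum_distrib_left
    by (subst sum.swap, rule sum.cong[OF refl], subst sum.swap, rule refl)
  also have "\<dots> = (\<Sum>j\<in>?X. \<Sum>k\<in>?X. if k = j then (if k \<in> S then x j * cnj (x k) else 0) else 0)"
    unfolding gram by (intro sum.cong) auto
  also have "\<dots> = (\<Sum>j\<in>?X. if j \<in> S then x j * cnj (x j) else 0)"
    using fx by simp
  also have "\<dots> = complex_of_real (\<Sum>j\<in>?X. if j \<in> S then (cmod (x j))\<^sup>2 else 0)"
    by (simp only: of_real_sum) (intro sum.cong, auto simp: complex_norm_square simp del: of_real_power)
  finally have "(\<Sum>i\<in>?R. (cmod (\<Sum>j\<in>?X. entry a i j * x j))\<^sup>2)
      = (\<Sum>j\<in>?X. if j \<in> S then (cmod (x j))\<^sup>2 else 0)"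
    by (simp only: of_real_eq_iff)
  also have "\<dots> \<le> (\<Sum>j\<in>?X. (cmod (x j))\<^sup>2)"
    by (intro sum_mono) auto
  finally have "y \<le> L2_set (\<lambda>j. cmod (x j)) ?X"
    unfolding y L2_set_def by simp
  with x show "y \<le> 1" by simp
qed

section \<open>Complex matrices as finitely supported ones\<close>

lift_definition finmat_of_mat :: "complex mat \<Rightarrow> finmat" is
  "\<lambda>a i j. if i < dim_row a \<and> j < dim_col a then a $$ (i, j) else 0"
proof -
  fix a :: "complex mat"
  show "finite {(i, j). (if i < dim_row a \<and> j < dim_col a then a $$ (i, j) else 0) \<noteq> 0}"
    by (rule finite_subset[of _ "{..<dim_row a} \<times> {..<dim_col a}"]) auto
qed

lemmas entry_finmat_of_mat [simp] = finmat_of_mat.rep_eq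

lemma finmat_of_cadjoint: "finmat_of_mat (cadjoint a) = adjF (finmat_of_mat a)"
  by (auto intro!: finmat_eqI simp: cadjoint_def)

text \<open>Padding by zeros creates no new nonzero rows and ignores the coordinates of a vector
  beyond the column range, so both suprema are taken over the same set of lengths.\<close>

lemma normF_finmat_of_mat: "normF (finmat_of_mat a) = opnorm a"
proof -
  let ?m = "dim_row a" and ?n = "dim_col a" and ?a = "finmat_of_mat a"
  let ?R = "{i. \<exists>j. entry ?a i j \<noteq> 0}"
  \<comment> \<open>\<open>z\<close> agrees with \<open>x\<close> on the column range; this covers
    both truncating an infinite vector and padding a finite one.\<close>
  have val: "L2_set (\<lambda>i. cmod (\<Sum>j | x j \<noteq> 0. entry ?a i j * x j)) ?R
      = L2_set (\<lambda>i. cmod ((a *\<^sub>v z) $ i)) {..<?m}"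
    if x: "finite {j. x j \<noteq> 0}" and z: "z \<in> carrier_vec ?n" and xz: "\<And>j. j < ?n \<Longrightarrow> z $ j = x j"
    for x and z :: "complex vec"
  proof -
    have eq: "(\<Sum>j | x j \<noteq> 0. entry ?a i j * x j) = (a *\<^sub>v z) $ i" if "i < ?m" for i
    proof -
      have "(\<Sum>j | x j \<noteq> 0. entry ?a i j * x j) = (\<Sum>j\<in>{..<?n} \<union> {j. x j \<noteq> 0}. entry ?a i j * x j)"
        using x by (intro sum.mono_neutral_left) auto
      also have "\<dots> = (\<Sum>j<?n. entry ?a i j * x j)"
        using x by (intro sum.mono_neutral_right) auto
      also have "\<dots> = (\<Sum>j<?n. a $$ (i, j) * z $ j)"
        using that xz by simp
      also have "\<dots> = (a *\<^sub>v z) $ i"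
        using that z by (auto simp: scalar_prod_def lessThan_atLeast0)
      finally show ?thesis .
    qed
    have zero: "(\<Sum>j | x j \<noteq> 0. entry ?a i j * x j) = 0" if "i \<notin> ?R" for i
      using that by (intro sum.neutral) (simp del: entry_finmat_of_mat)
    have "?R \<subseteq> {..<?m}" by auto
    then have "L2_set (\<lambda>i. cmod (\<Sum>j | x j \<noteq> 0. entry ?a i j * x j)) ?R
        = L2_set (\<lambda>i. cmod (\<Sum>j | x j \<noteq> 0. entry ?a i j * x j)) {..<?m}"
      unfolding L2_set_def using zero
      by (intro arg_cong[where f = sqrt] sum.mono_neutral_left)
        (simp_all del: entry_finmat_of_mat)
    also have "\<dots> = L2_set (\<lambda>i. cmod ((a *\<^sub>v z) $ i)) {..<?m}"
      by (rule L2_set_cong) (simp_all add: eq del: entry_finmat_of_mat)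
    finally show ?thesis .
  qed
  have "{L2_set (\<lambda>i. cmod (\<Sum>j | x j \<noteq> 0. entry ?a i j * x j)) ?R | x.
      finite {j. x j \<noteq> 0} \<and> L2_set (\<lambda>j. cmod (x j)) {j. x j \<noteq> 0} \<le> 1}
    = {L2_set (\<lambda>i. cmod ((a *\<^sub>v z) $ i)) {..<?m} | z.
      z \<in> carrier_vec ?n \<and> L2_set (\<lambda>j. cmod (z $ j)) {..<?n} \<le> 1}" (is "?A = ?B")
  proof (intro equalityI subsetI)
    fix y assume "y \<in> ?A"
    then obtain x where fx: "finite {j. x j \<noteq> 0}"
      and x: "L2_set (\<lambda>j. cmod (x j)) {j. x j \<noteq> 0} \<le> 1"
      and y: "y = L2_set (\<lambda>i. cmod (\<Sum>j | x j \<noteq> 0. entry ?a i j * x j)) ?R"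
      by blast
    define z where "z = vec ?n x"
    have "L2_set (\<lambda>j. cmod (z $ j)) {..<?n} = L2_set (\<lambda>j. cmod (x j)) {..<?n}"
      by (rule L2_set_cong) (auto simp: z_def)
    also have "\<dots> = L2_set (\<lambda>j. cmod (x j)) ({..<?n} \<inter> {j. x j \<noteq> 0})"
      unfolding L2_set_def by (rule arg_cong[where f = sqrt], rule sum.mono_neutral_right) auto
    also have "\<dots> \<le> L2_set (\<lambda>j. cmod (x j)) {j. x j \<noteq> 0}"
      unfolding L2_set_def real_sqrt_le_iff by (rule sum_mono2[OF fx]) auto
    finally have "L2_set (\<lambda>j. cmod (z $ j)) {..<?n} \<le> 1" using x by simp
    moreover have "y = L2_set (\<lambda>i. cmod ((a *\<^sub>v z) $ i)) {..<?m}"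
      unfolding y by (rule val[OF fx]) (auto simp: z_def)
    moreover have "z \<in> carrier_vec ?n" by (simp add: z_def)
    ultimately show "y \<in> ?B" by blast
  next
    fix y assume "y \<in> ?B"
    then obtain z where z: "z \<in> carrier_vec ?n"
      and nz: "L2_set (\<lambda>j. cmod (z $ j)) {..<?n} \<le> 1"
      and y: "y = L2_set (\<lambda>i. cmod ((a *\<^sub>v z) $ i)) {..<?m}"
      by blast
    define x where "x = (\<lambda>j. if j < ?n then z $ j else 0)"
    have sub: "{j. x j \<noteq> 0} \<subseteq> {..<?n}" by (auto simp: x_def split: if_splits)
    then have fx: "finite {j. x j \<noteq> 0}" by (rule finite_subset) simp
    have "L2_set (\<lambda>j. cmod (x j)) {j. x j \<noteq> 0} = L2_set (\<lambda>j. cmod (x j)) {..<?n}"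
      unfolding L2_set_def using sub by (intro arg_cong[where f = sqrt] sum.mono_neutral_left) auto
    also have "\<dots> = L2_set (\<lambda>j. cmod (z $ j)) {..<?n}"
      by (rule L2_set_cong) (auto simp: x_def)
    finally have "L2_set (\<lambda>j. cmod (x j)) {j. x j \<noteq> 0} \<le> 1" using nz by simp
    moreover have "y = L2_set (\<lambda>i. cmod (\<Sum>j | x j \<noteq> 0. entry ?a i j * x j)) ?R"
      unfolding y by (rule val[OF fx z, symmetric]) (auto simp: x_def)
    ultimately show "y \<in> ?A" using fx by blast
  qed
  then show ?thesis by (simp add: normF_def opnorm_def)
qed


section \<open>Coordinates of a bimodule\<close>

context F_bimodule
begin

lemma lact_zero_left [simp]: "0 \<triangleright> v = 0"
  using lact_add_left[of 0 0 v] by simp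

lemma lact_zero_right [simp]: "a \<triangleright> 0 = 0"
  using lact_add_right[of a 0 0] by simp

lemma ract_zero_left [simp]: "0 \<triangleleft> a = 0"
  using ract_add_left[of 0 0 a] by simp

lemma ract_zero_right [simp]: "v \<triangleleft> 0 = 0"
  using ract_add_right[of v 0 0] by simp

lemma lact_minus_left: "(- a) \<triangleright> v = - (a \<triangleright> v)"
  using lact_add_left[of "- a" a v] by (simp add: eq_neg_iff_add_eq_0)

lemma lact_minus_right: "a \<triangleright> (- v) = - (a \<triangleright> v)"
  using lact_add_right[of a "- v" v] by (simp add: eq_neg_iff_add_eq_0)

lemma ract_minus_left: "(- v) \<triangleleft> a = - (v \<triangleleft> a)"
  using ract_add_left[of "- v" v a] by (simp add: eq_neg_iff_add_eq_0)

lemma ract_minus_right: "v \<triangleleft> (- a) = - (v \<triangleleft> a)"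
  using ract_add_right[of v "- a" a] by (simp add: eq_neg_iff_add_eq_0)

lemma lact_diff_left: "(a - b) \<triangleright> v = a \<triangleright> v - b \<triangleright> v"
  using lact_add_left[of a "- b" v] by (simp add: lact_minus_left)

lemma lact_diff_right: "a \<triangleright> (u - v) = a \<triangleright> u - a \<triangleright> v"
  using lact_add_right[of a u "- v"] by (simp add: lact_minus_right)

lemma ract_diff_left: "(u - v) \<triangleleft> a = u \<triangleleft> a - v \<triangleleft> a"
  using ract_add_left[of u "- v" a] by (simp add: ract_minus_left)

lemma ract_diff_right: "v \<triangleleft> (a - b) = v \<triangleleft> a - v \<triangleleft> b"
  using ract_add_right[of v a "- b"] by (simp add: ract_minus_right)

lemma lact_sum_left: "sum f S \<triangleright> v = (\<Sum>k\<in>S. f k \<triangleright> v)"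
  by (induction S rule: infinite_finite_induct) (auto simp: lact_add_left)

lemma lact_sum_right: "a \<triangleright> sum f S = (\<Sum>k\<in>S. a \<triangleright> f k)"
  by (induction S rule: infinite_finite_induct) (auto simp: lact_add_right)

lemma ract_sum_left: "sum f S \<triangleleft> a = (\<Sum>k\<in>S. f k \<triangleleft> a)"
  by (induction S rule: infinite_finite_induct) (auto simp: ract_add_left)

lemma ract_sum_right: "v \<triangleleft> sum f S = (\<Sum>k\<in>S. v \<triangleleft> f k)"
  by (induction S rule: infinite_finite_induct) (auto simp: ract_add_right)

lemmas act_distribs = lact_add_left lact_add_right ract_add_left ract_add_right
  lact_minus_left lact_minus_right ract_minus_left ract_minus_right
  lact_diff_left lact_diff_right ract_diff_left ract_diff_right

lemmas act_assocs = lact_ract lact_mult[symmetric] ract_mult[symmetric] mult.assoc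

section \<open>Coordinates and the rectangular form of \<open>T\<close>\<close>

definition coord :: "nat \<Rightarrow> nat \<Rightarrow> 'v \<Rightarrow> 'v" where
  "coord i j v = unitF 0 i \<triangleright> v \<triangleleft> unitF j 0"

text \<open>The square map \<open>T\<close> does not suffice: scalar multiplication and absolute
  values change the format of a matrix.\<close>

definition T_rect :: "nat \<Rightarrow> nat \<Rightarrow> 'v mat \<Rightarrow> 'v" where
  "T_rect m n v = (\<Sum>i<m. \<Sum>j<n. unitF i 0 \<triangleright> v $$ (i, j) \<triangleleft> unitF 0 j)"

definition T_inv :: "nat \<Rightarrow> nat \<Rightarrow> 'v \<Rightarrow> 'v mat" where
  "T_inv m n w = mat m n (\<lambda>(i, j). coord i j w)"

lemma T_eq_T_rect: "T n = T_rect n n"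
  by (simp add: T_def T_rect_def fun_eq_iff)

lemma IF_one: "IF 1 = unitF 0 0"
  by (simp add: IF_def)

lemma corner_iff: "v \<in> corner \<longleftrightarrow> unitF 0 0 \<triangleright> v \<triangleleft> unitF 0 0 = v"
  unfolding corner_def IF_one
  by (auto simp: act_assocs unitF_times_unitF) (metis rangeI)

lemma coord_mem_corner: "coord i j v \<in> corner"
  by (simp add: corner_iff coord_def act_assocs unitF_times_unitF)

lemma coord_add: "coord i j (u + v) = coord i j u + coord i j v"
  and coord_diff: "coord i j (u - v) = coord i j u - coord i j v"
  and coord_zero [simp]: "coord i j 0 = 0"
  by (simp_all add: coord_def act_distribs)

text \<open>One half of the bijection between matrices over the corner and elements fixed by
  \<open>IF m\<close> on the left and \<open>IF n\<close> on the right; the other half is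
  \<open>T_inv_T_rect\<close>.\<close>

lemma T_rect_T_inv: "T_rect m n (T_inv m n w) = IF m \<triangleright> w \<triangleleft> IF n"
proof -
  have "T_rect m n (T_inv m n w) = (\<Sum>i<m. \<Sum>j<n. unitF i i \<triangleright> w \<triangleleft> unitF j j)"
    unfolding T_rect_def T_inv_def
    by (intro sum.cong refl) (auto simp: coord_def act_assocs unitF_times_unitF)
  then show ?thesis
    by (simp add: IF_def lact_sum_left ract_sum_left ract_sum_right) (rule sum.swap)
qed

lemma coord_T_rect:
  assumes "v \<in> carrier_mat m n" "elements_mat v \<subseteq> corner"
  shows "coord k l (T_rect m n v) = (if k < m \<and> l < n then v $$ (k, l) else 0)"
proof -
  have "coord k l (T_rect m n v)
      = (\<Sum>i<m. \<Sum>j<n. (unitF 0 k * unitF i 0) \<triangleright> (v $$ (i, j) \<triangleleft> (unitF 0 j * unitF l 0)))"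
    unfolding coord_def T_rect_def
    by (simp add: lact_sum_right ract_sum_left act_assocs)
  also have "\<dots> = (\<Sum>i<m. \<Sum>j<n. if i = k then
      (if j = l then unitF 0 0 \<triangleright> (v $$ (i, j) \<triangleleft> unitF 0 0) else 0) else 0)"
    by (intro sum.cong refl) (auto simp: unitF_times_unitF)
  also have "\<dots> = (\<Sum>i<m. if i = k then (\<Sum>j<n. 
      (if j = l then unitF 0 0 \<triangleright> (v $$ (i, j) \<triangleleft> unitF 0 0) else 0)) else 0)"
    by (intro sum.cong refl) auto
  also have "\<dots> = (if k < m \<and> l < n then unitF 0 0 \<triangleright> (v $$ (k, l) \<triangleleft> unitF 0 0) else 0)"
    by simp
  also have "\<dots> = (if k < m \<and> l < n then v $$ (k, l) else 0)"
    using assms corner_iff[of "v $$ (k, l)"] by (auto simp: lact_ract)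
  finally show ?thesis .
qed

end

context nondegenerate_ordered_F_bimodule
begin

section \<open>Local units and scalar multiplication\<close>

lemma order_fix: "IF (order v) \<triangleright> v \<triangleleft> IF (order v) = v"
  using LeastI_ex[OF nondegenerate[of v]] unfolding order_def by auto

lemma order_le: "n > 0 \<Longrightarrow> IF n \<triangleright> v \<triangleleft> IF n = v \<Longrightarrow> order v \<le> n"
  unfolding order_def by (rule Least_le) simp

lemma IF_times_IF: "IF m * IF n = IF (min m n)"
  by (simp add: IF_eq_diagF diagF_times_diagF min_def ac_simps Int_absorb1 Int_absorb2)

lemma IF_fix:
  assumes "order v \<le> n"
  shows "IF n \<triangleright> v = v" "v \<triangleleft> IF n = v"
proof -
  let ?o = "order v"
  have "IF n * IF ?o = IF ?o" "IF ?o * IF n = IF ?o"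
    using assms by (simp_all add: IF_times_IF)
  then have "IF n \<triangleright> (IF ?o \<triangleright> v \<triangleleft> IF ?o) = IF ?o \<triangleright> v \<triangleleft> IF ?o"
    "(IF ?o \<triangleright> v \<triangleleft> IF ?o) \<triangleleft> IF n = IF ?o \<triangleright> v \<triangleleft> IF ?o"
    by (simp_all add: act_assocs)
  then show "IF n \<triangleright> v = v" "v \<triangleleft> IF n = v"
    by (simp_all add: order_fix)
qed

text \<open>The definition of \<open>scale\<close> uses the order, which varies with the vector. The
  scalar can be exchanged between \<open>IF n\<close> and \<open>IF (order v)\<close>, so any left
  local unit serves, and several vectors can share one.\<close>

lemma scale_eq:
  assumes "IF n \<triangleright> v = v"
  shows "scale z v = scaleF z (IF n) \<triangleright> v"
proof -
  have c: "scaleF z (IF n) * IF (order v) = scaleF z (IF (order v)) * IF n"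
    by (auto intro!: finmat_eqI simp: IF_eq_diagF entry_diagF)
  have "scaleF z (IF n) \<triangleright> v = scaleF z (IF n) \<triangleright> (IF (order v) \<triangleright> v)"
    by (simp add: IF_fix)
  also have "\<dots> = scaleF z (IF (order v)) \<triangleright> (IF n \<triangleright> v)"
    by (simp only: c lact_mult[symmetric])
  also have "\<dots> = scale z v"
    by (simp add: assms scale_def)
  finally show ?thesis by simp
qed

lemma scaleF_times: "scaleF z a * b = scaleF z (a * b)" and times_scaleF: "a * scaleF z b = scaleF z (a * b)"
  by (auto intro!: finmat_eqI)

lemma scaleF_lact: "scaleF z a \<triangleright> v = scale z (a \<triangleright> v)"
proof -
  obtain n where n: "IF n * a = a" using IF_absorbing[of a] by blast
  then have "IF n \<triangleright> (a \<triangleright> v) = a \<triangleright> v" by (simp flip: lact_mult)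
  then have "scale z (a \<triangleright> v) = (scaleF z (IF n) * a) \<triangleright> v"
    by (simp add: scale_eq lact_mult)
  then show ?thesis by (simp add: n scaleF_times)
qed

lemma lact_scale: "a \<triangleright> scale z v = scale z (a \<triangleright> v)"
proof -
  have "a \<triangleright> scale z v = (a * scaleF z (IF (order v))) \<triangleright> v"
    by (simp add: scale_def lact_mult)
  also have "\<dots> = (scaleF z a * IF (order v)) \<triangleright> v"
    by (simp add: scaleF_times times_scaleF)
  also have "\<dots> = scale z (a \<triangleright> v)"
    by (simp add: lact_mult IF_fix scaleF_lact)
  finally show ?thesis .
qed

lemma scale_ract: "scale z v \<triangleleft> b = scale z (v \<triangleleft> b)"
proof -
  have "scale z v \<triangleleft> b = scale z (IF (order v) \<triangleright> (v \<triangleleft> b))"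
    unfolding scale_def[of z v] by (subst lact_ract) (rule scaleF_lact)
  also have "IF (order v) \<triangleright> (v \<triangleleft> b) = v \<triangleleft> b"
    by (simp add: IF_fix flip: lact_ract)
  finally show ?thesis .
qed

text \<open>\<open>balanced\<close> with the local unit \<open>IF (order v)\<close> on the left
  carries the scalar from one side to the other.\<close>

lemma ract_scaleF: "v \<triangleleft> scaleF z b = scale z (v \<triangleleft> b)"
  using balanced[of z "IF (order v)" v b] by (simp add: IF_fix scaleF_lact scale_ract)

lemmas scale_pulls = scaleF_lact lact_scale ract_scaleF scale_ract

lemma scale_add_right: "scale z (u + v) = scale z u + scale z v"
proof -
  let ?n = "max (order u) (order v)"
  have "IF ?n \<triangleright> u = u" "IF ?n \<triangleright> v = v" "IF ?n \<triangleright> (u + v) = u + v"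
    by (simp_all add: IF_fix lact_add_right)
  then show ?thesis by (simp add: scale_eq[of ?n] lact_add_right)
qed

lemma scale_zero_right [simp]: "scale z 0 = 0"
  by (simp add: scale_def)

lemma scale_minus_right: "scale z (- v) = - scale z v"
  using scale_add_right[of z "- v" v] by (simp add: eq_neg_iff_add_eq_0)

lemma scale_diff_right: "scale z (u - v) = scale z u - scale z v"
  using scale_add_right[of z u "- v"] by (simp add: scale_minus_right)

lemma scale_add_left: "scale (z + w) v = scale z v + scale w v"
proof -
  have "scaleF (z + w) a = scaleF z a + scaleF w a" for a
    by (auto intro!: finmat_eqI simp: distrib_right)
  then show ?thesis by (simp add: scale_def lact_add_left)
qed

lemma scale_scale: "scale z (scale w v) = scale (z * w) v"
proof -
  have "scaleF (z * w) a = scaleF z (scaleF w a)" for a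
    by (auto intro!: finmat_eqI simp: mult.assoc)
  then show ?thesis by (simp add: scale_def[of "z * w"] scaleF_lact IF_fix)
qed

lemma scale_one [simp]: "scale 1 v = v"
proof -
  have "scaleF 1 a = a" for a by (auto intro!: finmat_eqI)
  then show ?thesis by (simp add: scale_def IF_fix)
qed

lemma scale_zero_left [simp]: "scale 0 v = 0"
  using scale_add_left[of 0 0 v] by simp

lemma scale_minus_left: "scale (- z) v = - scale z v"
  using scale_add_left[of "- z" z v] by (simp add: eq_neg_iff_add_eq_0)

lemma star_zero [simp]: "star 0 = 0"
  using star_add[of 0 0] by simp

lemma star_minus: "star (- v) = - star v"
  using star_add[of "- v" v] by (simp add: eq_neg_iff_add_eq_0)

lemma star_diff: "star (u - v) = star u - star v"
  using star_add[of u "- v"] by (simp add: star_minus)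

text \<open>The involution puts the scalar on the right, from where \<open>ract_scaleF\<close>
  brings it back.\<close>

lemma star_scale: "star (scale z v) = scale (cnj z) (star v)"
proof -
  have o: "star v \<triangleleft> IF (order v) = star v"
    using star_lact[of "IF (order v)" v] by (simp add: IF_eq_diagF) (simp add: IF_fix flip: IF_eq_diagF)
  have "star (scale z v) = star v \<triangleleft> scaleF (cnj z) (IF (order v))"
    by (simp add: scale_def star_lact IF_eq_diagF)
  then show ?thesis by (simp add: ract_scaleF o)
qed

text \<open>By non-degeneracy both elements are recovered from finitely many coordinates. The
  algebraic identities for \<open>T_rect\<close> are reduced to entries by this rule.\<close>

lemma coord_eqI:
  assumes "\<And>i j. coord i j u = coord i j v"
  shows "u = v"
proof -
  let ?n = "max (order u) (order v)"
  have "T_inv ?n ?n u = T_inv ?n ?n v"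
    by (simp add: T_inv_def assms)
  then have "IF ?n \<triangleright> u \<triangleleft> IF ?n = IF ?n \<triangleright> v \<triangleleft> IF ?n"
    by (metis T_rect_T_inv)
  then show ?thesis by (simp add: IF_fix)
qed

lemma coord_scale: "coord i j (scale z v) = scale z (coord i j v)"
  by (simp add: coord_def scale_pulls)

lemma coord_star: "coord i j (star v) = star (coord j i v)"
  by (simp add: coord_def star_lact star_ract lact_ract)

section \<open>The corner and matrices over it\<close>

lemma corner_closed:
  "0 \<in> corner" "u \<in> corner \<Longrightarrow> v \<in> corner \<Longrightarrow> u + v \<in> corner"
  "u \<in> corner \<Longrightarrow> v \<in> corner \<Longrightarrow> u - v \<in> corner"
  "v \<in> corner \<Longrightarrow> - v \<in> corner" "v \<in> corner \<Longrightarrow> scale z v \<in> corner"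
  by (simp_all add: corner_iff act_distribs scale_pulls)

lemma corner_star: "v \<in> corner \<Longrightarrow> star v \<in> corner"
  unfolding corner_iff by (metis adjF_simps(5) lact_ract star_lact star_ract)

lemma corner_sum: "(\<And>k. k \<in> S \<Longrightarrow> f k \<in> corner) \<Longrightarrow> sum f S \<in> corner"
  by (induction S rule: infinite_finite_induct) (auto simp: corner_closed)

sublocale mats: star_vector_space corner scale star
  by unfold_locales
    (simp_all add: corner_closed corner_star add_ac scale_add_right scale_add_left scale_scale
      star_add star_scale star_star)

lemma mats_M_iff:
  "v \<in> mats.M m n \<longleftrightarrow> dim_row v = m \<and> dim_col v = n \<and> (\<forall>i<m. \<forall>j<n. v $$ (i, j) \<in> corner)"
  by (auto simp: mats.M_def elements_mat_def image_subset_iff UN_subset_iff)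

lemma coord_T_rect' [simp]:
  "v \<in> mats.M m n \<Longrightarrow> coord k l (T_rect m n v) = (if k < m \<and> l < n then v $$ (k, l) else 0)"
  by (simp add: coord_T_rect mats.M_def)

lemma T_inv_mem: "T_inv m n w \<in> mats.M m n"
  by (simp add: mats_M_iff T_inv_def coord_mem_corner)

lemma T_inv_T_rect [simp]: "v \<in> mats.M m n \<Longrightarrow> T_inv m n (T_rect m n v) = v"
  by (rule eq_matI) (auto simp: T_inv_def mats_M_iff[of v])

lemma T_rect_inject: "u \<in> mats.M m n \<Longrightarrow> v \<in> mats.M m n \<Longrightarrow> T_rect m n u = T_rect m n v \<longleftrightarrow> u = v"
  by (metis T_inv_T_rect)

lemma T_rect_fix:
  assumes "v \<in> mats.M m n"
  shows "IF m \<triangleright> T_rect m n v = T_rect m n v" "T_rect m n v \<triangleleft> IF n = T_rect m n v"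
proof -
  have eq: "T_rect m n v = IF m \<triangleright> T_rect m n v \<triangleleft> IF n"
    using T_rect_T_inv[of m n "T_rect m n v"] assms by simp
  have "IF m \<triangleright> (IF m \<triangleright> w \<triangleleft> IF n) = IF m \<triangleright> w \<triangleleft> IF n"
    "(IF m \<triangleright> w \<triangleleft> IF n) \<triangleleft> IF n = IF m \<triangleright> w \<triangleleft> IF n" for w
    by (simp_all add: act_assocs IF_times_IF)
  then show "IF m \<triangleright> T_rect m n v = T_rect m n v" "T_rect m n v \<triangleleft> IF n = T_rect m n v"
    by (metis eq)+
qed

lemma order_T_rect: "v \<in> mats.M n n \<Longrightarrow> n > 0 \<Longrightarrow> order (T_rect n n v) \<le> n"
  by (simp add: order_le T_rect_fix)

lemma mats_M_closed:
  "0\<^sub>m m n \<in> mats.M m n"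
  "u \<in> mats.M m n \<Longrightarrow> v \<in> mats.M m n \<Longrightarrow> u + v \<in> mats.M m n"
  "u \<in> mats.M m n \<Longrightarrow> v \<in> mats.M m n \<Longrightarrow> u - v \<in> mats.M m n"
  "v \<in> mats.M m n \<Longrightarrow> - v \<in> mats.M m n"
  "v \<in> mats.M m n \<Longrightarrow> mats.mscale k v \<in> mats.M m n"
  "v \<in> mats.M m n \<Longrightarrow> mats.adj v \<in> mats.M n m"
  by (auto simp: mats_M_iff mats.mscale_def mats.adj_def corner_closed corner_star)

lemma mats_M_mul:
  "v \<in> mats.M m n \<Longrightarrow> a \<in> carrier_mat r m \<Longrightarrow> mats.lmul a v \<in> mats.M r n"
  "v \<in> mats.M m n \<Longrightarrow> b \<in> carrier_mat n s \<Longrightarrow> mats.rmul v b \<in> mats.M m s"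
  by (auto simp: mats_M_iff mats.lmul_def mats.rmul_def intro!: corner_sum corner_closed)

lemma mats_M_four_block:
  "\<lbrakk>a \<in> mats.M m n; b \<in> mats.M m s; c \<in> mats.M r n; d \<in> mats.M r s\<rbrakk>
    \<Longrightarrow> four_block_mat a b c d \<in> mats.M (m + r) (n + s)"
  by (auto simp: mats_M_iff)

section \<open>Compatibility of \<open>T_rect\<close> with the matrix operations\<close>

lemma T_rect_zero: "T_rect m n (0\<^sub>m m n) = 0"
  by (rule coord_eqI) (simp add: mats_M_closed)

lemma T_rect_add:
  "u \<in> mats.M m n \<Longrightarrow> v \<in> mats.M m n \<Longrightarrow> T_rect m n (u + v) = T_rect m n u + T_rect m n v"
  by (rule coord_eqI) (simp add: mats_M_closed coord_add, simp add: mats_M_iff)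

lemma T_rect_diff:
  "u \<in> mats.M m n \<Longrightarrow> v \<in> mats.M m n \<Longrightarrow> T_rect m n (u - v) = T_rect m n u - T_rect m n v"
  by (rule coord_eqI) (simp add: mats_M_closed coord_diff, simp add: mats_M_iff)

lemma T_rect_mscale:
  "v \<in> mats.M m n \<Longrightarrow> T_rect m n (mats.mscale k v) = rscale k (T_rect m n v)"
  by (rule coord_eqI) (simp add: mats_M_closed coord_scale, simp add: mats_M_iff mats.mscale_def)

lemma T_rect_adj: "v \<in> mats.M m n \<Longrightarrow> T_rect n m (mats.adj v) = star (T_rect m n v)"
  by (rule coord_eqI) (simp add: mats_M_closed coord_star, simp add: mats_M_iff mats.adj_def)

lemma T_rect_lmul:
  assumes v: "v \<in> mats.M m n" and a: "a \<in> carrier_mat r m"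
  shows "T_rect r n (mats.lmul a v) = finmat_of_mat a \<triangleright> T_rect m n v"
proof (rule coord_eqI)
  fix k l
  \<comment> \<open>Row \<open>k\<close> of the padded matrix, moved to row 0 and expanded in matrix
    units; it is zero for \<open>k \<ge> r\<close>.\<close>
  have "unitF 0 k * finmat_of_mat a = (\<Sum>p<m. scaleF (if k < r then a $$ (k, p) else 0) (unitF 0 p))"
    using a by (auto intro!: finmat_eqI simp: if_distrib[of "\<lambda>x. _ * x"] cong: if_cong)
  then have "coord k l (finmat_of_mat a \<triangleright> T_rect m n v)
      = (\<Sum>p<m. scale (if k < r then a $$ (k, p) else 0) (coord p l (T_rect m n v)))"
    by (simp add: coord_def lact_mult[symmetric] lact_sum_left ract_sum_left scale_pulls)
  then show "coord k l (T_rect r n (mats.lmul a v)) = coord k l (finmat_of_mat a \<triangleright> T_rect m n v)"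
    using v a by (simp add: mats_M_mul) (auto simp: mats.lmul_def mats_M_iff intro!: sum.neutral)
qed

lemma T_rect_rmul:
  assumes v: "v \<in> mats.M m n" and b: "b \<in> carrier_mat n s"
  shows "T_rect m s (mats.rmul v b) = T_rect m n v \<triangleleft> finmat_of_mat b"
proof (rule coord_eqI)
  fix k l
  have "finmat_of_mat b * unitF l 0 = (\<Sum>p<n. scaleF (if l < s then b $$ (p, l) else 0) (unitF p 0))"
    using b by (auto intro!: finmat_eqI simp: if_distrib[of "\<lambda>x. _ * x"] cong: if_cong)
  then have "coord k l (T_rect m n v \<triangleleft> finmat_of_mat b)
      = (\<Sum>p<n. scale (if l < s then b $$ (p, l) else 0) (coord k p (T_rect m n v)))"
    by (simp add: coord_def lact_ract ract_mult[symmetric] ract_sum_right lact_sum_right scale_pulls)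
  then show "coord k l (T_rect m s (mats.rmul v b)) = coord k l (T_rect m n v \<triangleleft> finmat_of_mat b)"
    using v b by (simp add: mats_M_mul) (auto simp: mats.rmul_def mats_M_iff intro!: sum.neutral)
qed

text \<open>The shifts place the blocks: \<open>adjF (shiftF m r)\<close> on the left moves a block
  down by \<open>m\<close> rows, \<open>shiftF n s\<close> on the right moves it \<open>n\<close>
  columns to the right.\<close>

lemma T_rect_four_block:
  assumes a: "a \<in> mats.M m n" and b: "b \<in> mats.M m s" and c: "c \<in> mats.M r n" and d: "d \<in> mats.M r s"
  shows "T_rect (m + r) (n + s) (four_block_mat a b c d)
    = T_rect m n a + T_rect m s b \<triangleleft> shiftF n s + adjF (shiftF m r) \<triangleright> T_rect r n c
      + adjF (shiftF m r) \<triangleright> T_rect r s d \<triangleleft> shiftF n s"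
proof (rule coord_eqI)
  fix k l
  have dims: "dim_row a = m" "dim_col a = n" "dim_row d = r" "dim_col d = s"
    using a d by (simp_all add: mats_M_iff)
  have left: "unitF 0 k * adjF (shiftF m r) = (if m \<le> k \<and> k < m + r then unitF 0 (k - m) else 0)"
    by (auto intro!: finmat_eqI)
  have right: "shiftF n s * unitF l 0 = (if n \<le> l \<and> l < n + s then unitF (l - n) 0 else 0)"
    by (auto intro!: finmat_eqI)
  have cl: "coord k l (adjF (shiftF m r) \<triangleright> w) = (if m \<le> k \<and> k < m + r then coord (k - m) l w else 0)" for w l
    by (simp add: coord_def left flip: lact_mult)
  have cr: "coord k l (w \<triangleleft> shiftF n s) = (if n \<le> l \<and> l < n + s then coord k (l - n) w else 0)" for w k
    by (simp add: coord_def lact_ract ract_mult[symmetric] right)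
  show "coord k l (T_rect (m + r) (n + s) (four_block_mat a b c d))
    = coord k l (T_rect m n a + T_rect m s b \<triangleleft> shiftF n s + adjF (shiftF m r) \<triangleright> T_rect r n c
      + adjF (shiftF m r) \<triangleright> T_rect r s d \<triangleleft> shiftF n s)"
    using dims by (simp add: assms mats_M_four_block coord_add cl cr) auto
qed

lemma T_rect_dsum:
  assumes "v \<in> mats.M m n" "w \<in> mats.M r s"
  shows "T_rect (m + r) (n + s) (mats.dsum v w)
    = T_rect m n v + adjF (shiftF m r) \<triangleright> T_rect r s w \<triangleleft> shiftF n s"
  using assms T_rect_four_block[OF assms(1) mats_M_closed(1) mats_M_closed(1) assms(2)]
  by (simp add: mats.dsum_def T_rect_zero) (simp add: mats_M_iff T_rect_zero)

lemma mats_M_dsum: "v \<in> mats.M m n \<Longrightarrow> w \<in> mats.M r s \<Longrightarrow> mats.dsum v w \<in> mats.M (m + r) (n + s)"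
  by (auto simp: mats.dsum_def mats_M_iff corner_closed)

end


section \<open>Order and norm\<close>

context nondegenerate_ordered_F_bimodule
begin

section \<open>Compression of two by two blocks\<close>

lemma IF_adj [simp]: "adjF (IF n) = IF n"
  by (simp add: IF_eq_diagF)

lemma JF_adjF_JF: "JF n * adjF (JF n) = IF n"
  by (simp add: JF_eq_shiftF IF_eq_diagF shiftF_times_adjF_shiftF)

lemma JF_IF: "m \<le> n \<Longrightarrow> JF n * IF m = 0"
  and IF_JF: "m \<le> n \<Longrightarrow> IF n * JF m = JF m"
  and IF_adjF_JF: "m \<le> n \<Longrightarrow> IF m * adjF (JF n) = 0"
  by (auto intro!: finmat_eqI simp: JF_eq_shiftF IF_eq_diagF entry_diagF)

text \<open>\<open>pair n x y + sa n v\<close> is the block matrix with diagonal \<open>x\<close>,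
  \<open>y\<close> and off-diagonal \<open>v\<close>, \<open>star v\<close>. Compressing it by
  \<open>d\<close> depends only on the upper part \<open>IF n * d\<close> and the lower part
  \<open>JF n * d\<close> of \<open>d\<close>.\<close>

lemma conj_pair_sa:
  assumes "IF n \<triangleright> x \<triangleleft> IF n = x"
  shows "adjF d \<triangleright> (pair n x y + sa n v) \<triangleleft> d
    = adjF (IF n * d) \<triangleright> x \<triangleleft> (IF n * d) + adjF (JF n * d) \<triangleright> y \<triangleleft> (JF n * d)
      + (adjF (IF n * d) \<triangleright> v \<triangleleft> (JF n * d) + adjF (JF n * d) \<triangleright> star v \<triangleleft> (IF n * d))"
proof -
  have "adjF (IF n * d) \<triangleright> x \<triangleleft> (IF n * d) = adjF d \<triangleright> (IF n \<triangleright> x \<triangleleft> IF n) \<triangleleft> d"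
    by (simp add: act_assocs)
  then have "adjF (IF n * d) \<triangleright> x \<triangleleft> (IF n * d) = adjF d \<triangleright> x \<triangleleft> d"
    by (simp only: assms)
  then show ?thesis
    unfolding pair_def sa_def act_distribs by (simp add: act_assocs)
qed

text \<open>Compression of a $2 \times 2$ block by the column with entries $1$ and $c$.\<close>

lemma pair_sa_column:
  fixes c :: real
  assumes P: "pair n x y + sa n v \<in> Pos"
    and x: "IF n \<triangleright> x \<triangleleft> IF n = x" and y: "IF n \<triangleright> y \<triangleleft> IF n = y" and v: "IF n \<triangleright> v \<triangleleft> IF n = v"
  shows "x + rscale (c\<^sup>2) y + rscale c (v + star v) \<in> Pos"
proof -
  let ?d = "IF n + scaleF c (adjF (JF n))"
  have A: "IF n * ?d = IF n" and B: "JF n * ?d = scaleF c (IF n)"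
    by (auto simp: distrib_left times_scaleF IF_times_IF IF_adjF_JF JF_IF JF_adjF_JF intro!: finmat_eqI)
  have "star (IF n \<triangleright> v \<triangleleft> IF n) = star v" by (simp only: v)
  then have v': "IF n \<triangleright> star v \<triangleleft> IF n = star v"
    by (simp add: star_lact star_ract lact_ract)
  have "adjF ?d \<triangleright> (pair n x y + sa n v) \<triangleleft> ?d \<in> Pos"
    by (rule Pos_conj[OF P])
  then show ?thesis
    unfolding conj_pair_sa[OF x] A B
    by (simp add: x y v v' scale_pulls scale_scale scale_add_right power2_eq_square)
qed

end

context local_F_order_unit_bimodule
begin

section \<open>The order and positive elements\<close>

lemma zero_Pos: "0 \<in> Pos"
  using proper by blast

lemma Pos_antisym: "v \<in> Pos \<Longrightarrow> - v \<in> Pos \<Longrightarrow> v = 0"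
  using proper by force

lemma le_antisym: "u \<preceq> v \<Longrightarrow> v \<preceq> u \<Longrightarrow> u = v"
  using Pos_antisym[of "v - u"] by (simp add: le_def)

lemma le_trans: "u \<preceq> v \<Longrightarrow> v \<preceq> w \<Longrightarrow> u \<preceq> w"
  using Pos_add[of "v - u" "w - v"] by (simp add: le_def)

lemma le_conj: "u \<preceq> v \<Longrightarrow> adjF a \<triangleright> u \<triangleleft> a \<preceq> adjF a \<triangleright> v \<triangleleft> a"
  using Pos_conj[of "v - u" a] by (simp add: le_def act_distribs)

text \<open>Multiplication by \<open>k\<close> is conjugation by a local unit times the square root
  of \<open>k\<close>.\<close>

lemma Pos_scale:
  assumes "v \<in> Pos" "k \<ge> 0"
  shows "rscale k v \<in> Pos"
proof -
  have "adjF (scaleF (sqrt k) (IF (order v))) \<triangleright> v \<triangleleft> scaleF (sqrt k) (IF (order v)) \<in> Pos"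
    by (rule Pos_conj) fact
  then show ?thesis
    using assms(2) by (simp add: scale_pulls scale_scale IF_fix flip: of_real_mult)
qed

lemma Pos_scale_cancel: "rscale k v \<in> Pos \<Longrightarrow> k > 0 \<Longrightarrow> v \<in> Pos"
  using Pos_scale[of "rscale k v" "1 / k"] by (simp add: scale_scale flip: of_real_mult)

lemma Pos_sum: "(\<And>i. i \<in> S \<Longrightarrow> f i \<in> Pos) \<Longrightarrow> sum f S \<in> Pos"
  by (induction S rule: infinite_finite_induct) (auto simp: zero_Pos Pos_add)

text \<open>On the complement of \<open>S\<close> the diagonal block of \<open>u\<close> lies
  between 0 and 0, hence vanishes. The off-diagonal part then vanishes as well: otherwise scaling it
  freely against the block on \<open>S\<close> would contradict the Archimedean property and
  properness.\<close>

lemma Pos_le_supported: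
  assumes u: "u \<in> Pos" and le: "u \<preceq> w" and S: "finite S"
    and w: "diagF S \<triangleright> w \<triangleleft> diagF S = w"
  shows "diagF S \<triangleright> u = u" "u \<triangleleft> diagF S = u"
proof -
  obtain N0 where "\<forall>i\<in>S. i < N0" using S finite_nat_set_iff_bounded by blast
  then obtain N where N: "S \<subseteq> {..<N}" "order u \<le> N"
    by (metis lessThan_iff less_le_trans max.cobounded1 max.cobounded2 subsetI)
  let ?p = "diagF S" and ?q = "diagF ({..<N} - S)"
  have pq: "?p + ?q = IF N" and qp: "?q * ?p = 0" and pp: "?p * ?p = ?p" and qq: "?q * ?q = ?q"
    and pq0: "?p * ?q = 0"
    using S N by (auto intro!: finmat_eqI simp: IF_eq_diagF entry_diagF)
  have "adjF ?q \<triangleright> (w - u) \<triangleleft> ?q \<in> Pos"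
    by (rule Pos_conj) (use le in \<open>simp add: le_def\<close>)
  moreover have "?q \<triangleright> (?p \<triangleright> w \<triangleleft> ?p) \<triangleleft> ?q = 0"
    by (simp add: act_assocs) (simp add: qp flip: mult.assoc lact_mult)
  then have "?q \<triangleright> w \<triangleleft> ?q = 0" by (simp only: w)
  ultimately have "- (?q \<triangleright> u \<triangleleft> ?q) \<in> Pos" by (simp add: act_distribs)
  moreover have "?q \<triangleright> u \<triangleleft> ?q \<in> Pos" using Pos_conj[OF u, of ?q] by simp
  ultimately have quq: "?q \<triangleright> u \<triangleleft> ?q = 0" using Pos_antisym by blast
  define x where "x = ?p \<triangleright> u \<triangleleft> ?p"
  define y where "y = ?p \<triangleright> u \<triangleleft> ?q + ?q \<triangleright> u \<triangleleft> ?p"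
  have x: "x \<in> Pos" using Pos_conj[OF u, of ?p] by (simp add: x_def)
  have y: "star y = y"
    by (simp add: y_def star_add star_lact star_ract Pos_sa[OF u] lact_ract)
  \<comment> \<open>Conjugation by \<open>p + t q\<close> keeps the block on \<open>S\<close>,
    multiplies the off-diagonal part by \<open>t\<close> and sees the vanishing block only with the
    factor \<open>t * t\<close>.\<close>
  have t: "x + rscale t y \<in> Pos" for t
  proof -
    let ?a = "?p + scaleF t ?q"
    have "adjF ?a \<triangleright> u \<triangleleft> ?a = x + rscale t y + rscale (t * t) (?q \<triangleright> u \<triangleleft> ?q)"
      by (simp add: act_distribs scale_pulls scale_scale x_def y_def scale_add_right add_ac)
    then show ?thesis using Pos_conj[OF u, of ?a] by (simp add: quq)
  qed
  \<comment> \<open>With \<open>t = 1 / k\<close> and \<open>t = - 1 / k\<close> this gives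
    \<open>k x + y\<close> and \<open>k x - y\<close>, the form the Archimedean property asks
    for.\<close>
  have s: "rscale k x + rscale (k * t) y \<in> Pos" if "k > 0" for k t
    using Pos_scale[OF t[of t], of k] that by (simp add: scale_add_right scale_scale)
  have "y \<in> Pos"
  proof (rule archimedean[OF y x])
    fix k :: real assume "k > 0"
    then show "rscale k x + y \<in> Pos" using s[of k "1 / k"] by simp
  qed
  moreover have "- y \<in> Pos"
  proof (rule archimedean[OF _ x])
    show "star (- y) = - y" by (simp add: star_minus y)
    fix k :: real assume "k > 0"
    then show "rscale k x + - y \<in> Pos"
      using s[of k "- 1 / k"] by (simp add: scale_minus_left)
  qed
  ultimately have "y = 0" using Pos_antisym by blast
  have "u = (?p + ?q) \<triangleright> u \<triangleleft> (?p + ?q)" by (simp add: pq IF_fix N)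
  also have "\<dots> = x + y + ?q \<triangleright> u \<triangleleft> ?q" by (simp add: act_distribs x_def y_def add_ac)
  finally have "u = x" by (simp add: quq \<open>y = 0\<close>)
  moreover have "?p \<triangleright> x = x" "x \<triangleleft> ?p = x"
    by (simp_all add: x_def act_assocs) (simp_all add: pp flip: lact_mult)
  ultimately show "?p \<triangleright> u = u" "u \<triangleleft> ?p = u" by simp_all
qed

section \<open>The amplified unit and the block size in the norm\<close>

lemma amplify_IF: "IF m \<triangleright> amplify n e = amplify (min m n) e" "amplify n e \<triangleleft> IF m = amplify (min m n) e"
proof -
  have *: "{..<n} \<inter> {i. i < m} = {..<min m n}" by auto
  have "IF m * unitF i 0 = (if i < m then unitF i 0 else 0)"
    "unitF 0 i * IF m = (if i < m then unitF 0 i else 0)" for i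
    by (auto intro!: finmat_eqI simp: IF_eq_diagF entry_diagF)
  then have "IF m \<triangleright> (unitF i 0 \<triangleright> e \<triangleleft> unitF 0 i) = (if i < m then unitF i 0 \<triangleright> e \<triangleleft> unitF 0 i else 0)"
    "(unitF i 0 \<triangleright> e \<triangleleft> unitF 0 i) \<triangleleft> IF m = (if i < m then unitF i 0 \<triangleright> e \<triangleleft> unitF 0 i else 0)" for i
    by (simp_all add: act_assocs)
  then show "IF m \<triangleright> amplify n e = amplify (min m n) e" "amplify n e \<triangleleft> IF m = amplify (min m n) e"
    by (simp_all add: amplify_def lact_sum_right ract_sum_left sum.If_cases *)
qed

lemma amplify_mono:
  assumes "m \<le> n"
  shows "amplify n e - amplify m e \<in> Pos"
proof -
  have "amplify n e - amplify m e = (\<Sum>i\<in>{m..<n}. unitF i 0 \<triangleright> e \<triangleleft> unitF 0 i)"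
    unfolding amplify_def lessThan_atLeast0 by (rule sum_diff_nat_ivl) (simp_all add: assms)
  also have "\<dots> \<in> Pos"
    using Pos_conj[OF unit_Pos, of "unitF 0 _"] by (intro Pos_sum) simp
  finally show ?thesis .
qed

text \<open>A larger block size only moves the lower block to another offset and adds positive
  diagonal terms where \<open>w\<close> is zero.\<close>

lemma pair_sa_amplify_iff:
  assumes k: "k \<ge> 0" and w: "IF m \<triangleright> w = w" "w \<triangleleft> IF m = w" and mn: "m \<le> n"
  shows "pair n (rscale k (amplify n e)) (rscale k (amplify n e)) + sa n w \<in> Pos
    \<longleftrightarrow> pair m (rscale k (amplify m e)) (rscale k (amplify m e)) + sa m w \<in> Pos"
    (is "?P n \<longleftrightarrow> ?P m")
proof
  let ?x = "\<lambda>n. rscale k (amplify n e)"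
  have x: "IF l \<triangleright> ?x l \<triangleleft> IF l = ?x l" for l
    by (simp add: scale_pulls amplify_IF)
  have "star (w \<triangleleft> IF m) = star w" "star (IF m \<triangleright> w) = star w" by (simp_all only: w)
  then have w': "IF m \<triangleright> star w = star w" "star w \<triangleleft> IF m = star w"
    by (simp_all add: star_lact star_ract)
  have ww: "w \<triangleleft> (IF m * b) = w \<triangleleft> b" "star w \<triangleleft> (IF m * b) = star w \<triangleleft> b" for b
    by (simp_all add: ract_mult w w')
  have wn: "IF n \<triangleright> w = w" "star w \<triangleleft> IF n = star w"
    using w w' mn by (metis IF_times_IF lact_mult min_absorb2, metis IF_times_IF ract_mult min_absorb1)
  show "?P m" if "?P n"
  proof -
    \<comment> \<open>Compression by this element moves the lower block from offset \<open>n\<close>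
      to offset \<open>m\<close> and keeps the first \<open>m\<close> coordinates of both
      blocks.\<close>
    let ?d = "IF m + adjF (JF n) * JF m"
    have A: "IF n * ?d = IF m"
      using mn by (simp add: distrib_left IF_times_IF IF_adjF_JF flip: mult.assoc)
    have B: "JF n * ?d = JF m"
      using mn by (simp add: distrib_left JF_IF JF_adjF_JF IF_JF flip: mult.assoc)
    have "IF m \<triangleright> (?x n) \<triangleleft> IF m = ?x m" "adjF (JF m) \<triangleright> ?x n \<triangleleft> JF m = adjF (JF m) \<triangleright> ?x m \<triangleleft> JF m"
    proof -
      show "IF m \<triangleright> (?x n) \<triangleleft> IF m = ?x m" using mn by (simp add: scale_pulls amplify_IF)
      then have "adjF (JF m) \<triangleright> ?x m \<triangleleft> JF m = adjF (IF m * JF m) \<triangleright> ?x n \<triangleleft> (IF m * JF m)"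
        by (simp add: act_assocs flip: \<open>IF m \<triangleright> (?x n) \<triangleleft> IF m = ?x m\<close>)
      then show "adjF (JF m) \<triangleright> ?x n \<triangleleft> JF m = adjF (JF m) \<triangleright> ?x m \<triangleleft> JF m"
        by (simp only: IF_JF order_refl)
    qed
    then have "adjF ?d \<triangleright> (pair n (?x n) (?x n) + sa n w) \<triangleleft> ?d = pair m (?x m) (?x m) + sa m w"
      unfolding conj_pair_sa[OF x] A B unfolding pair_def sa_def by simp
    then show ?thesis using Pos_conj[OF that, of ?d] by simp
  qed
  show "?P n" if "?P m"
  proof -
    \<comment> \<open>The opposite move: the lower block goes from offset \<open>m\<close> to offset
      \<open>n\<close>.\<close>
    let ?d = "IF m + adjF (JF m) * JF n"
    have A: "IF m * ?d = IF m"
      by (simp add: distrib_left IF_times_IF IF_adjF_JF flip: mult.assoc)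
    have B: "JF m * ?d = IF m * JF n"
      by (simp add: distrib_left JF_IF JF_adjF_JF flip: mult.assoc)
    have xm: "?x m \<triangleleft> IF m = ?x m" "IF m \<triangleright> ?x m = ?x m"
      by (simp_all add: scale_pulls amplify_IF)
    have xx: "adjF (IF m * JF n) \<triangleright> ?x m \<triangleleft> (IF m * JF n) = adjF (JF n) \<triangleright> ?x m \<triangleleft> JF n"
      by (simp add: lact_mult ract_mult lact_ract xm)
    have xw: "adjF (IF m) \<triangleright> w \<triangleleft> (IF m * JF n) = IF n \<triangleright> w \<triangleleft> JF n"
      by (simp add: w wn ww)
    have xw': "adjF (IF m * JF n) \<triangleright> star w \<triangleleft> IF m = adjF (JF n) \<triangleright> star w \<triangleleft> IF n"
      by (simp add: lact_mult lact_ract w' wn)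
    have "adjF ?d \<triangleright> (pair m (?x m) (?x m) + sa m w) \<triangleleft> ?d
        = ?x m + adjF (JF n) \<triangleright> ?x m \<triangleleft> JF n + sa n w"
      unfolding conj_pair_sa[OF x] A B unfolding sa_def xx xw xw' by (simp add: x[simplified])
    then have P: "?x m + adjF (JF n) \<triangleright> ?x m \<triangleleft> JF n + sa n w \<in> Pos"
      using Pos_conj[OF that, of ?d] by simp
    \<comment> \<open>After the move the diagonal still carries \<open>amplify m e\<close>. The
      missing part of \<open>amplify n e\<close> is positive, as \<open>k \<ge> 0\<close>, and is
      added to both diagonal blocks.\<close>
    have d: "?x n - ?x m \<in> Pos"
      using Pos_scale[OF amplify_mono[OF mn] k] by (simp add: scale_diff_right)
    show ?thesis
      using Pos_add[OF P Pos_add[OF d Pos_conj[OF d, of "JF n"]]]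
      by (simp add: pair_def act_distribs algebra_simps)
  qed
qed

text \<open>The matrix norm is taken at a fixed size \<open>n\<close>, whereas the order of an
  element of the range of \<open>T_rect n n\<close> may be smaller.\<close>

lemma normV_eq:
  assumes "order w \<le> n"
  shows "normV w = Inf {k. k > 0 \<and>
    pair n (rscale k (amplify n e)) (rscale k (amplify n e)) + sa n w \<in> Pos}"
proof -
  have "k > 0 \<and> pair n (rscale k (amplify n e)) (rscale k (amplify n e)) + sa n w \<in> Pos \<longleftrightarrow>
    k > 0 \<and> pair (order w) (rscale k (amplify (order w) e)) (rscale k (amplify (order w) e))
      + sa (order w) w \<in> Pos" for k
    using pair_sa_amplify_iff[of k "order w" w n] assms by (auto simp: IF_fix)
  then show ?thesis unfolding normV_def by presburger
qed

section \<open>Matrix cones and the order unit\<close>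

definition cone :: "nat \<Rightarrow> 'v mat set" where
  "cone n = {v \<in> mats.M n n. T_rect n n v \<in> Pos}"

lemma mats_M_sa_iff:
  "v \<in> mats.M_sa n \<longleftrightarrow> v \<in> mats.M n n \<and> star (T_rect n n v) = T_rect n n v"
  unfolding mats.M_sa_def
  by (auto simp flip: T_rect_adj simp: T_rect_inject mats_M_closed)

lemma cone_subset: "cone n \<subseteq> mats.M_sa n"
  by (auto simp: cone_def mats_M_sa_iff Pos_sa)

sublocale mats: matrix_ordered_space corner scale star cone
proof (intro matrix_ordered_space.intro matrix_ordered_space_axioms.intro mats.star_vector_space_axioms)
  fix m n :: nat and v :: "'v mat" and a :: "complex mat"
  assume "v \<in> cone n" "a \<in> carrier_mat n m"
  then have v: "v \<in> mats.M n n" "T_rect n n v \<in> Pos" and a: "a \<in> carrier_mat n m"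
    and a': "cadjoint a \<in> carrier_mat m n"
    by (auto simp: cone_def cadjoint_def)
  have l: "mats.lmul (cadjoint a) v \<in> mats.M m n"
    using v(1) a' by (rule mats_M_mul)
  show "mats.rmul (mats.lmul (cadjoint a) v) a \<in> cone m"
    unfolding cone_def using Pos_conj[OF v(2), of "finmat_of_mat a"]
    by (simp add: T_rect_rmul[OF l a] T_rect_lmul[OF v(1) a'] mats_M_mul(2)[OF l a] finmat_of_cadjoint)
next
  fix n :: nat
  have M: "v \<in> mats.M n n" if "v \<in> mats.M_sa n" for v
    using that by (simp add: mats_M_sa_iff)
  show "real_ordered_vector_space (mats.M_sa n) (0\<^sub>m n n) mats.mscale (cone n)"
  proof (intro real_ordered_vector_space.intro vector_space_on.intro
      real_ordered_vector_space_axioms.intro cone_subset)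
    fix x y z :: "'v mat" and k l :: real
    assume "x \<in> mats.M_sa n"
    then have x: "dim_row x = n" "dim_col x = n" using M[of x] by (simp_all add: mats_M_iff)
    show "- x \<in> mats.M_sa n"
    proof -
      \<comment> \<open>Negation is reduced to a difference, for which \<open>T_rect_diff\<close> is
        available.\<close>
      have "0\<^sub>m n n - x = - x" using x by (auto intro!: eq_matI)
      then show ?thesis
        using \<open>x \<in> _\<close> T_rect_diff[of "0\<^sub>m n n" n n x]
        by (simp add: mats_M_sa_iff mats_M_closed T_rect_zero star_minus)
    qed
    show "mats.mscale k x \<in> mats.M_sa n"
      using \<open>x \<in> _\<close> by (simp add: mats_M_sa_iff mats_M_closed T_rect_mscale star_scale)
    show "0\<^sub>m n n + x = x" using x by (auto intro!: eq_matI)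
    show "x + - x = 0\<^sub>m n n" using x by (auto intro!: eq_matI)
    show "mats.mscale (k + l) x = mats.mscale k x + mats.mscale l x"
      "mats.mscale k (mats.mscale l x) = mats.mscale (k * l) x" "mats.mscale 1 x = x"
      using x by (auto intro!: eq_matI simp: mats.mscale_def scale_add_left scale_scale)
    assume "y \<in> mats.M_sa n"
    then have y: "dim_row y = n" "dim_col y = n" using M[of y] by (simp_all add: mats_M_iff)
    show "x + y \<in> mats.M_sa n"
      using \<open>x \<in> _\<close> \<open>y \<in> _\<close> by (simp add: mats_M_sa_iff mats_M_closed T_rect_add star_add)
    show "x + y = y + x" "x - y = x + - y"
      "mats.mscale k (x + y) = mats.mscale k x + mats.mscale k y"
      using x y by (auto intro!: eq_matI simp: mats.mscale_def scale_add_right)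
    assume "z \<in> mats.M_sa n"
    then have z: "dim_row z = n" "dim_col z = n" using M[of z] by (simp_all add: mats_M_iff)
    show "x + y + z = x + (y + z)"
      using x y z by (auto intro!: eq_matI)
  next
    show "0\<^sub>m n n \<in> mats.M_sa n" by (simp add: mats_M_sa_iff mats_M_closed T_rect_zero)
    show "0\<^sub>m n n \<in> cone n" by (simp add: cone_def mats_M_closed T_rect_zero zero_Pos)
  next
    fix x y assume "x \<in> cone n" "y \<in> cone n"
    then show "x + y \<in> cone n" by (simp add: cone_def mats_M_closed T_rect_add Pos_add)
  next
    fix x :: "'v mat" and k :: real assume "x \<in> cone n" "k \<ge> 0"
    then show "mats.mscale k x \<in> cone n" by (simp add: cone_def mats_M_closed T_rect_mscale Pos_scale)
  qed
qed

lemma mats_V_pos_iff: "v \<in> mats.V_pos \<longleftrightarrow> v \<in> corner \<and> v \<in> Pos"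
proof -
  have "T_rect 1 1 (mat 1 1 (\<lambda>_. v)) = v" if "v \<in> corner"
    using that by (simp add: T_rect_def corner_iff)
  then show ?thesis
    by (auto simp: mats.V_pos_def cone_def mats_M_iff)
qed

lemma unit_mem_corner: "e \<in> corner"
  using unit_corner unfolding corner_iff IF_one .

sublocale mats: matrix_order_unit_space corner scale star cone e
proof unfold_locales
  show "e \<in> mats.V_pos"
    by (simp add: mats_V_pos_iff unit_Pos unit_mem_corner)
next
  fix v assume "v \<in> mats.V_sa"
  then have v: "v \<in> corner" "star v = v" by (simp_all add: mats.V_sa_def)
  obtain k where k: "k > 0" "pair 1 (rscale k e) (rscale k e) + sa 1 v \<in> Pos"
    using local_order_unit[OF v(1)] by blast
  have "IF 1 \<triangleright> v \<triangleleft> IF 1 = v" "IF 1 \<triangleright> rscale k e \<triangleleft> IF 1 = rscale k e"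
    using v(1) unfolding corner_iff IF_one[symmetric] by (simp_all only: scale_pulls unit_corner)
  \<comment> \<open>The block given by the local order unit, compressed by the column with entries 1
    and \<open>c\<close>. The choices \<open>c = 1\<close> and \<open>c = - 1\<close> yield the two
    order bounds, up to a factor 2.\<close>
  then have P: "rscale k e + rscale (c\<^sup>2) (rscale k e) + rscale c (v + v) \<in> Pos" for c
    using pair_sa_column[OF k(2), of c] v(2) by simp
  have two: "scale 2 u = u + u" for u
    using scale_add_left[of 1 1 u] by simp
  have "rscale 2 (rscale k e + v) \<in> Pos" "rscale 2 (rscale k e - v) \<in> Pos"
    using P[of 1] P[of "- 1"]
    by (simp_all add: scale_minus_left two algebra_simps)
  then have "rscale k e + v \<in> Pos" "rscale k e - v \<in> Pos"
    using Pos_scale_cancel[of 2] by simp_all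
  then show "\<exists>k>0. rscale k e + v \<in> mats.V_pos \<and> rscale k e - v \<in> mats.V_pos"
    using k(1) v(1) by (auto simp: mats_V_pos_iff corner_closed unit_mem_corner)
next
  show "mats.V_pos \<inter> uminus ` mats.V_pos = {0}"
    using Pos_antisym zero_Pos corner_closed(1) by (auto simp: mats_V_pos_iff)
next
  fix n x u
  assume x: "x \<in> mats.M_sa n" and u: "u \<in> cone n" and *: "\<And>k. k > 0 \<Longrightarrow> mats.mscale k u + x \<in> cone n"
  have "T_rect n n x \<in> Pos"
  proof (rule archimedean)
    show "star (T_rect n n x) = T_rect n n x" "T_rect n n u \<in> Pos"
      using x u by (simp_all add: mats_M_sa_iff cone_def)
    fix k :: real assume "k > 0"
    from *[OF this] show "rscale k (T_rect n n u) + T_rect n n x \<in> Pos"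
      using x u by (simp add: cone_def mats_M_sa_iff T_rect_add mats_M_closed T_rect_mscale)
  qed
  then show "x \<in> cone n" using x by (simp add: cone_def mats_M_sa_iff)
qed

section \<open>The matrix norm and orthogonality in norm\<close>

lemma mats_unit_mat: "mats.unit_mat n \<in> mats.M n n" "T_rect n n (mats.unit_mat n) = amplify n e"
proof -
  show "mats.unit_mat n \<in> mats.M n n"
    by (auto simp: mats_M_iff mats.unit_mat_def unit_mem_corner corner_closed)
  show "T_rect n n (mats.unit_mat n) = amplify n e"
    unfolding T_rect_def amplify_def mats.unit_mat_def
    by (intro sum.cong refl)
      (simp add: if_distrib[of "\<lambda>v. _ \<triangleright> v"] if_distrib[of "\<lambda>v. v \<triangleleft> _"] cong: if_cong)
qed

text \<open>At size \<open>2 * n\<close> the block matrix defining \<open>mnorm\<close> becomes the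
  block element defining the norm of the module, taken at size \<open>n\<close> instead of the
  order; \<open>normV_eq\<close> removes that difference.\<close>

lemma mats_mnorm:
  assumes v: "v \<in> mats.M n n" and n: "n > 0"
  shows "mats.mnorm n v = normV (T_rect n n v)"
proof -
  let ?E = "\<lambda>k. mats.mscale k (mats.unit_mat n)"
  have E: "?E k \<in> mats.M n n" for k
    by (simp add: mats_M_closed mats_unit_mat)
  have "four_block_mat (?E k) v (mats.adj v) (?E k) \<in> mats.M (2 * n) (2 * n)" for k
    using mats_M_four_block[OF E v mats_M_closed(6)[OF v] E] by (simp add: mult_2)
  moreover have "T_rect (2 * n) (2 * n) (four_block_mat (?E k) v (mats.adj v) (?E k))
      = pair n (rscale k (amplify n e)) (rscale k (amplify n e)) + sa n (T_rect n n v)" for k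
  proof -
    have "T_rect n n (?E k) = rscale k (amplify n e)"
      by (simp add: T_rect_mscale mats_unit_mat)
    moreover have "star (T_rect n n v) \<triangleleft> IF n = star (T_rect n n v)"
      using T_rect_fix(1)[OF v] star_lact[of "IF n" "T_rect n n v"] by simp
    ultimately show ?thesis
      using T_rect_four_block[OF E v mats_M_closed(6)[OF v] E, of k k]
      by (simp add: mult_2 pair_def sa_def JF_eq_shiftF T_rect_adj[OF v] T_rect_fix[OF v] lact_ract)
  qed
  ultimately have "four_block_mat (?E k) v (mats.adj v) (?E k) \<in> cone (2 * n) \<longleftrightarrow>
      pair n (rscale k (amplify n e)) (rscale k (amplify n e)) + sa n (T_rect n n v) \<in> Pos" for k
    by (simp add: cone_def)
  then show ?thesis
    by (simp add: mats.mnorm_def normV_eq[OF order_T_rect[OF v n]])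
qed

lemma mats_mperp_inf:
  assumes "u \<in> mats.M n n" "v \<in> mats.M n n" "n > 0"
  shows "mats.mperp_inf n u v \<longleftrightarrow> perp_inf (T_rect n n u) (T_rect n n v)"
  unfolding mats.mperp_inf_def perp_inf_def
  using assms by (simp add: mats_mnorm mats_M_closed T_rect_add T_rect_mscale)

lemma mem_range_T_rect:
  assumes "IF n \<triangleright> w = w" "w \<triangleleft> IF n = w"
  obtains v where "v \<in> mats.M n n" "T_rect n n v = w"
  using that[of "T_inv n n w"] assms by (simp add: T_inv_mem T_rect_T_inv)

text \<open>On the module side the quantifiers range over all of \<open>Pos\<close>. Positive
  elements below one in the range of \<open>T_rect n n\<close> stay in that range by
  \<open>Pos_le_supported\<close>, so both sides test the same pairs.\<close>

lemma mats_mperp_inf_a: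
  assumes u: "u \<in> cone n" and v: "v \<in> cone n" and n: "n > 0"
  shows "mats.mperp_inf_a n u v \<longleftrightarrow> perp_inf_a (T_rect n n u) (T_rect n n v)"
proof -
  have below: "(\<forall>x\<in>Pos. x \<preceq> T_rect n n w \<longrightarrow> Q x)
      \<longleftrightarrow> (\<forall>y\<in>cone n. w - y \<in> cone n \<longrightarrow> Q (T_rect n n y))" if w: "w \<in> cone n" for w Q
  proof (intro iffI ballI impI)
    fix y assume "\<forall>x\<in>Pos. x \<preceq> T_rect n n w \<longrightarrow> Q x" "y \<in> cone n" "w - y \<in> cone n"
    then show "Q (T_rect n n y)" using w by (simp add: cone_def le_def T_rect_diff)
  next
    fix x assume *: "\<forall>y\<in>cone n. w - y \<in> cone n \<longrightarrow> Q (T_rect n n y)" "x \<in> Pos" "x \<preceq> T_rect n n w"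
    have "IF n \<triangleright> T_rect n n w \<triangleleft> IF n = T_rect n n w"
      using w by (simp add: cone_def T_rect_fix)
    then have "IF n \<triangleright> x = x" "x \<triangleleft> IF n = x"
      using Pos_le_supported[of x "T_rect n n w" "{..<n}"] * by (simp_all add: IF_eq_diagF)
    then obtain y where y: "y \<in> mats.M n n" "T_rect n n y = x" by (rule mem_range_T_rect)
    then show "Q x" using * w by (auto simp: cone_def le_def T_rect_diff mats_M_closed)
  qed
  have "perp_inf_a (T_rect n n u) (T_rect n n v) \<longleftrightarrow>
      (\<forall>u1\<in>Pos. u1 \<preceq> T_rect n n u \<longrightarrow>
        (\<forall>v1\<in>Pos. v1 \<preceq> T_rect n n v \<longrightarrow> perp_inf u1 v1))"
    unfolding perp_inf_a_def by blast
  also have "\<dots> \<longleftrightarrow> (\<forall>u1\<in>cone n. u - u1 \<in> cone n \<longrightarrow>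
      (\<forall>v1\<in>cone n. v - v1 \<in> cone n \<longrightarrow> perp_inf (T_rect n n u1) (T_rect n n v1)))"
    unfolding below[OF u] below[OF v] ..
  also have "\<dots> \<longleftrightarrow> mats.mperp_inf_a n u v"
    unfolding mats.mperp_inf_a_def using n mats_mperp_inf by (auto simp: cone_def)
  finally show ?thesis ..
qed

end


section \<open>The absolute value\<close>

context nondegenerate_absolute_order_unital_F_bimodule
begin

declare le_trans [trans]

section \<open>Contractions and partial isometries\<close>

lemma le_scale: "u \<preceq> v \<Longrightarrow> k \<ge> 0 \<Longrightarrow> rscale k u \<preceq> rscale k v"
  using Pos_scale[of "v - u" k] by (simp add: le_def scale_diff_right)

lemma normF_IF_le: "normF (IF n) \<le> 1"
  by (rule normF_le_one[of "{..<n}"]) (simp_all add: IF_eq_diagF diagF_times_diagF)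

text \<open>The gap to the bound of \<open>absv_act\<close> is the nonnegative number
  \<open>1 - normF a\<close> times a positive element.\<close>

lemma absv_act_le:
  assumes "normF a \<le> 1"
  shows "absv (a \<triangleright> v \<triangleleft> b) \<preceq> absv (absv v \<triangleleft> b)"
proof (rule le_trans[OF absv_act])
  have "rscale (1 - normF a) (absv (absv v \<triangleleft> b)) \<in> Pos"
    by (rule Pos_scale) (simp_all add: absv_Pos assms)
  moreover have "rscale (1 - normF a) y + rscale (normF a) y = y" for y
    by (simp flip: scale_add_left)
  ultimately show "rscale (normF a) (absv (absv v \<triangleleft> b)) \<preceq> absv (absv v \<triangleleft> b)"
    unfolding le_def by (metis add_diff_cancel_right')
qed

text \<open>A large local unit as right factor is invisible on both sides, and the outer absolute
  value disappears because \<open>absv v\<close> is positive.\<close>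

lemma absv_lact_le:
  assumes "normF a \<le> 1"
  shows "absv (a \<triangleright> v) \<preceq> absv v"
proof -
  define n where "n = max (order (a \<triangleright> v)) (order (absv v))"
  have "absv (a \<triangleright> v \<triangleleft> IF n) \<preceq> absv (absv v \<triangleleft> IF n)"
    by (rule absv_act_le) fact
  then show ?thesis
    by (simp add: n_def IF_fix absv_of_Pos absv_Pos)
qed

lemma absv_ract_le: "absv (v \<triangleleft> b) \<preceq> absv (absv v \<triangleleft> b)"
  using absv_act_le[OF normF_IF_le, of "order v" v b] by (simp add: IF_fix)

text \<open>Both \<open>a\<close> and \<open>adjF a\<close> are contractions, and
  \<open>adjF a\<close> undoes \<open>a\<close> on \<open>v\<close>, so \<open>absv_lact_le\<close>
  applies in both directions.\<close>

lemma absv_lact: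
  assumes "finite S" "finite S'" "adjF a * a = diagF S" "a * adjF a = diagF S'" "diagF S \<triangleright> v = v"
  shows "absv (a \<triangleright> v) = absv v"
proof (rule le_antisym)
  show "absv (a \<triangleright> v) \<preceq> absv v"
    by (rule absv_lact_le) (rule normF_le_one[OF assms(1,3)])
  have "normF (adjF a) \<le> 1"
    by (rule normF_le_one[OF assms(2)]) (simp add: assms(4))
  from absv_lact_le[OF this, of "a \<triangleright> v"] show "absv v \<preceq> absv (a \<triangleright> v)"
    by (simp add: assms(3,5) flip: lact_mult)
qed

text \<open>
  If \<open>v = v p\<close> for a diagonal projection \<open>p\<close>, the symmetry \<open>b = p - q\<close> fixes \<open>v\<close> from the right,
  which forces \<open>|v|\<close> to commute with \<open>p\<close>; then \<open>|v| \<le> | |v| p | = p |v| p\<close>.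
\<close>

lemma absv_supported:
  assumes S: "finite S" and v: "v \<triangleleft> diagF S = v"
  shows "diagF S \<triangleright> absv v = absv v" "absv v \<triangleleft> diagF S = absv v"
proof -
  obtain N0 where N0: "\<forall>i\<in>S. i < N0" using S finite_nat_set_iff_bounded by blast
  define N where "N = max N0 (max (order v) (order (absv v)))"
  have N: "S \<subseteq> {..<N}" "order v \<le> N" "order (absv v) \<le> N"
    using N0 by (auto simp: N_def less_max_iff_disj)
  let ?p = "diagF S" and ?q = "diagF ({..<N} - S)" and ?x = "absv v"
  let ?b = "?p - ?q"
  have pq: "?p + ?q = IF N" and pq0: "?p * ?q = 0" and bb: "?b * ?b = IF N"
    and pb: "?p * ?b = ?p" and bq: "?b * ?q = - ?q"
    using S N by (auto intro!: finmat_eqI simp: IF_eq_diagF entry_diagF left_diff_distrib right_diff_distrib)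
  have "v \<triangleleft> ?b = v \<triangleleft> (?p * ?b)" unfolding ract_mult v ..
  then have vb: "v \<triangleleft> ?b = v" by (simp only: pb v)
  have nb: "normF ?b \<le> 1"
    by (rule normF_le_one[of "{..<N}"]) (simp_all add: bb flip: IF_eq_diagF)
  have "?x = absv (v \<triangleleft> ?b)" by (simp only: vb)
  also have "\<dots> \<preceq> absv (?x \<triangleleft> ?b)" by (rule absv_ract_le)
  finally have x_le: "?x \<preceq> absv (?x \<triangleleft> ?b)" .
  \<comment> \<open>As \<open>b * b\<close> fixes \<open>x\<close>, a left factor \<open>b\<close>
    can be split off. It is a contraction and drops out, leaving the positive element
    \<open>b x b\<close>.\<close>
  have "?x \<triangleleft> ?b = ?b \<triangleright> (?b \<triangleright> ?x \<triangleleft> ?b)"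
    by (simp add: lact_ract bb flip: lact_mult) (simp add: IF_fix N flip: lact_ract)
  then have "absv (?x \<triangleleft> ?b) = absv (?b \<triangleright> (?b \<triangleright> ?x \<triangleleft> ?b))" by (simp only:)
  also have "absv (?b \<triangleright> (?b \<triangleright> ?x \<triangleleft> ?b)) \<preceq> absv (?b \<triangleright> ?x \<triangleleft> ?b)"
    by (rule absv_lact_le[OF nb])
  also have "\<dots> = ?b \<triangleright> ?x \<triangleleft> ?b"
    using Pos_conj[OF absv_Pos, of ?b v] by (simp add: absv_of_Pos)
  finally have le: "?x \<preceq> ?b \<triangleright> ?x \<triangleleft> ?b" by (rule le_trans[OF x_le])
  \<comment> \<open>Conjugating the inequality by \<open>b\<close> swaps its two sides, so equality
    holds.\<close>
  have "?b \<triangleright> ?x \<triangleleft> ?b \<preceq> ?b \<triangleright> (?b \<triangleright> ?x \<triangleleft> ?b) \<triangleleft> ?b"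
    using le_conj[OF le, of ?b] by simp
  also have "?b \<triangleright> (?b \<triangleright> ?x \<triangleleft> ?b) \<triangleleft> ?b = IF N \<triangleright> ?x \<triangleleft> IF N"
    by (simp add: act_assocs bb)
  also have "\<dots> = ?x"
    by (simp add: IF_fix N)
  finally have eq: "?x = ?b \<triangleright> ?x \<triangleleft> ?b" using le le_antisym by blast
  \<comment> \<open>From \<open>p b = p\<close> and \<open>b q = - q\<close> the off-diagonal block
    equals its own negative.\<close>
  have "?p \<triangleright> ?x \<triangleleft> ?q = ?p \<triangleright> (?b \<triangleright> ?x \<triangleleft> ?b) \<triangleleft> ?q" by (simp flip: eq)
  also have "\<dots> = (?p * ?b) \<triangleright> ?x \<triangleleft> (?b * ?q)" by (simp only: act_assocs)
  also have "\<dots> = - (?p \<triangleright> ?x \<triangleleft> ?q)" by (simp add: pb bq ract_minus_right)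
  finally have "?p \<triangleright> ?x \<triangleleft> ?q + ?p \<triangleright> ?x \<triangleleft> ?q = 0" by (simp only: eq_neg_iff_add_eq_0)
  then have "scale 2 (?p \<triangleright> ?x \<triangleleft> ?q) = 0"
    using scale_add_left[of 1 1 "?p \<triangleright> ?x \<triangleleft> ?q"] by simp
  then have "scale (1 / 2) (scale 2 (?p \<triangleright> ?x \<triangleleft> ?q)) = 0" by simp
  then have pxq: "?p \<triangleright> ?x \<triangleleft> ?q = 0" by (simp add: scale_scale)
  then have "star (?p \<triangleright> ?x \<triangleleft> ?q) = 0" by simp
  then have qxp: "?q \<triangleright> ?x \<triangleleft> ?p = 0"
    by (simp add: star_lact star_ract Pos_sa absv_Pos lact_ract)
  have "?x \<triangleleft> ?p = (?p + ?q) \<triangleright> ?x \<triangleleft> ?p"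
    by (simp add: pq IF_fix N)
  then have xp: "?x \<triangleleft> ?p = ?p \<triangleright> ?x \<triangleleft> ?p"
    by (simp add: act_distribs qxp)
  have pos: "?p \<triangleright> ?x \<triangleleft> ?p \<in> Pos"
    using Pos_conj[OF absv_Pos, of ?p v] by simp
  have "?x = absv (v \<triangleleft> ?p)" by (simp only: v)
  also have "\<dots> \<preceq> absv (?x \<triangleleft> ?p)" by (rule absv_ract_le)
  also have "\<dots> = ?p \<triangleright> ?x \<triangleleft> ?p" unfolding xp by (rule absv_of_Pos[OF pos])
  finally have "?x \<preceq> ?p \<triangleright> ?x \<triangleleft> ?p" .
  moreover have "?p \<triangleright> (?p \<triangleright> ?x \<triangleleft> ?p) \<triangleleft> ?p = ?p \<triangleright> ?x \<triangleleft> ?p"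
    using S by (simp add: act_assocs diagF_times_diagF)
  ultimately show "?p \<triangleright> ?x = ?x" "?x \<triangleleft> ?p = ?x"
    using Pos_le_supported[OF absv_Pos _ S] by blast+
qed

text \<open>By \<open>absv_supported\<close>, \<open>b * adjF b\<close> fixes \<open>absv v\<close>,
  so \<open>absv v\<close> times \<open>b\<close> is \<open>b\<close> times the conjugate of
  \<open>absv v\<close>, and the contraction \<open>b\<close> on the left drops out. This gives
  \<open>half\<close>; applied to \<open>v b\<close> and \<open>adjF b\<close> it gives the reverse
  inequality.\<close>

lemma absv_ract:
  assumes S: "finite S" "finite S'" and b: "b * adjF b = diagF S" "adjF b * b = diagF S'"
    and v: "v \<triangleleft> diagF S = v"
  shows "absv (v \<triangleleft> b) = adjF b \<triangleright> absv v \<triangleleft> b"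
proof -
  have half: "absv (v \<triangleleft> b) \<preceq> adjF b \<triangleright> absv v \<triangleleft> b"
    if S: "finite S" "finite S'" and b: "b * adjF b = diagF S" "adjF b * b = diagF S'"
      and v: "v \<triangleleft> diagF S = v" for S S' b v
  proof -
    let ?x = "absv v"
    have "b \<triangleright> (adjF b \<triangleright> ?x \<triangleleft> b) = (b * adjF b) \<triangleright> ?x \<triangleleft> b" by (simp only: act_assocs)
    also have "\<dots> = ?x \<triangleleft> b" by (simp only: b(1) absv_supported[OF S(1) v])
    finally have "absv (v \<triangleleft> b) \<preceq> absv (b \<triangleright> (adjF b \<triangleright> ?x \<triangleleft> b))"
      using absv_ract_le[of v b] by simp
    also have "\<dots> \<preceq> absv (adjF b \<triangleright> ?x \<triangleleft> b)"
      by (rule absv_lact_le) (rule normF_le_one[OF S(2) b(2)])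
    also have "\<dots> = adjF b \<triangleright> ?x \<triangleleft> b"
      by (rule absv_of_Pos) (rule Pos_conj[OF absv_Pos])
    finally show ?thesis .
  qed
  let ?y = "absv (v \<triangleleft> b)"
  have vbb: "(v \<triangleleft> b) \<triangleleft> adjF b = v" by (simp only: b(1) v flip: ract_mult)
  have "(v \<triangleleft> b) \<triangleleft> diagF S' = ((v \<triangleleft> b) \<triangleleft> adjF b) \<triangleleft> b" by (simp only: ract_mult flip: b(2))
  then have vb: "(v \<triangleleft> b) \<triangleleft> diagF S' = v \<triangleleft> b" by (simp only: vbb)
  have "absv ((v \<triangleleft> b) \<triangleleft> adjF b) \<preceq> adjF (adjF b) \<triangleright> ?y \<triangleleft> adjF b"
    by (rule half[OF S(2,1)]) (simp_all add: b vb)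
  then have "absv v \<preceq> b \<triangleright> ?y \<triangleleft> adjF b" by (simp only: vbb adjF_simps)
  from le_conj[OF this, of b]
  have "adjF b \<triangleright> absv v \<triangleleft> b \<preceq> (adjF b * b) \<triangleright> ?y \<triangleleft> (adjF b * b)" by (simp only: act_assocs)
  also have "\<dots> = ?y" by (simp only: b(2) absv_supported[OF S(2) vb])
  finally show ?thesis using half[OF S b v] le_antisym by blast
qed

text \<open>
  Independence requires row and column supports to be disjoint from each other as well; this is
  arranged by shifting all rows beyond the columns, which does not change absolute values.
\<close>

lemma absv_add_disjoint:
  assumes fin: "finite A" "finite A'" "finite B" "finite B'"
    and disj: "A \<inter> A' = {}" "B \<inter> B' = {}"
    and x: "diagF A \<triangleright> x = x" "x \<triangleleft> diagF B = x"
    and y: "diagF A' \<triangleright> y = y" "y \<triangleleft> diagF B' = y"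
  shows "absv (x + y) = absv x + absv y"
proof -
  have "finite (A \<union> A' \<union> B \<union> B')" using fin by simp
  then obtain N where N: "A \<union> A' \<union> B \<union> B' \<subseteq> {..<N}"
    unfolding finite_nat_set_iff_bounded by blast
  define u where "u = adjF (shiftF N N)"
  have uu: "adjF u * u = diagF {..<N}" "u * adjF u = diagF {N..<N + N}"
    by (simp_all add: u_def shiftF_times_adjF_shiftF adjF_shiftF_times_shiftF)
  have abs_u: "absv (u \<triangleright> z) = absv z" if "diagF {..<N} \<triangleright> z = z" for z
    by (rule absv_lact[OF _ _ uu that]) simp_all
  have sub: "diagF {..<N} \<triangleright> z = z" if "diagF C \<triangleright> z = z" "C \<subseteq> {..<N}" for C z
  proof -
    have "diagF {..<N} * diagF C = diagF C"
      using that(2) finite_subset[OF that(2)] by (simp add: diagF_times_diagF Int_absorb1)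
    then show ?thesis using that(1) by (metis lact_mult)
  qed
  \<comment> \<open>Independence asks for one index set on both sides. For the shifted element it
    consists of the columns \<open>D\<close> and the rows \<open>C\<close> moved by
    \<open>N\<close>.\<close>
  have supp: "diagF ((+) N ` C \<union> D) \<triangleright> (u \<triangleright> z) \<triangleleft> diagF ((+) N ` C \<union> D) = u \<triangleright> z"
    if "diagF C \<triangleright> z = z" "z \<triangleleft> diagF D = z" "finite C" "finite D" "C \<subseteq> {..<N}" for C D z
  proof -
    let ?S = "(+) N ` C \<union> D"
    have "diagF ?S * (u * diagF C) = u * diagF C"
      using that(3-5) by (auto intro!: finmat_eqI simp: u_def entry_diagF)
        (metis imageI le_add_diff_inverse)+
    moreover have "diagF D * diagF ?S = diagF D"
      using that(3,4) by (simp add: diagF_times_diagF Int_absorb2)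
    moreover have "diagF ?S \<triangleright> (u \<triangleright> (diagF C \<triangleright> (z \<triangleleft> diagF D))) \<triangleleft> diagF ?S
        = (diagF ?S * (u * diagF C)) \<triangleright> (z \<triangleleft> (diagF D * diagF ?S))"
      by (simp only: act_assocs)
    moreover have "diagF C \<triangleright> (z \<triangleleft> diagF D) = z" by (simp add: that)
    ultimately show ?thesis by (simp add: lact_mult that)
  qed
  have ind: "independent (u \<triangleright> x) (u \<triangleright> y)"
    unfolding independent_def
  proof (intro exI conjI)
    show "diagF ((+) N ` A \<union> B) \<triangleright> (u \<triangleright> x) \<triangleleft> diagF ((+) N ` A \<union> B) = u \<triangleright> x"
      "diagF ((+) N ` A' \<union> B') \<triangleright> (u \<triangleright> y) \<triangleleft> diagF ((+) N ` A' \<union> B') = u \<triangleright> y"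
      using supp x y fin N by auto
    show "((+) N ` A \<union> B) \<inter> ((+) N ` A' \<union> B') = {}"
      using disj N by auto
  qed (use fin in auto)
  have "diagF {..<N} \<triangleright> x = x" "diagF {..<N} \<triangleright> y = y"
    using sub x y N by auto
  moreover from this have "diagF {..<N} \<triangleright> (x + y) = x + y" by (simp add: lact_add_right)
  ultimately show ?thesis
    using absv_independent[OF ind] by (simp add: abs_u flip: lact_add_right)
qed

section \<open>Real multiples and self-adjoint elements\<close>

lemma absv_scale: "absv (rscale c v) = rscale \<bar>c\<bar> (absv v)"
proof (cases "c = 0")
  case True
  then show ?thesis by (simp add: absv_of_Pos zero_Pos)
next
  case False
  have le: "absv (rscale c v) \<preceq> rscale \<bar>c\<bar> (absv v)" if "c \<noteq> 0" for c v
  proof -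
    define n where "n = max (order v) (order (absv v))"
    have n: "IF n \<triangleright> v = v" "v \<triangleleft> IF n = v" "absv v \<triangleleft> IF n = absv v"
      by (simp_all add: n_def IF_fix)
    \<comment> \<open>The sign goes to the left, where only a contraction is allowed; the modulus
      goes to the right, where it multiplies the positive element \<open>absv v\<close>.\<close>
    have "normF (scaleF (sgn c) (IF n)) \<le> 1"
      using \<open>c \<noteq> 0\<close> by (intro normF_le_one[of "{..<n}"])
        (auto intro!: finmat_eqI simp: IF_eq_diagF entry_diagF sgn_real_def)
    from absv_act_le[OF this, of v "scaleF \<bar>c\<bar> (IF n)"]
    have "absv (scale (sgn c * \<bar>c\<bar>) v) \<preceq> absv (rscale \<bar>c\<bar> (absv v))"
      by (simp add: scale_pulls scale_scale n mult.commute)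
    moreover have "complex_of_real (sgn c) * complex_of_real \<bar>c\<bar> = complex_of_real c"
      by (simp add: sgn_mult_abs flip: of_real_mult)
    ultimately show ?thesis by (simp add: absv_of_Pos Pos_scale absv_Pos)
  qed
  show ?thesis
  proof (rule le_antisym[OF le[OF False]])
    \<comment> \<open>The reverse inequality comes from \<open>le\<close> for the inverse scalar and
      the vector \<open>c v\<close>.\<close>
    have "absv (rscale (1 / c) (rscale c v)) \<preceq> rscale \<bar>1 / c\<bar> (absv (rscale c v))"
      using False by (intro le) simp
    from le_scale[OF this, of "\<bar>c\<bar>"]
    have "rscale \<bar>c\<bar> (absv (rscale (1 / c) (rscale c v)))
        \<preceq> rscale \<bar>c\<bar> (rscale \<bar>1 / c\<bar> (absv (rscale c v)))"
      by simp
    moreover have "rscale (1 / c) (rscale c w) = w" "rscale \<bar>c\<bar> (rscale \<bar>1 / c\<bar> w) = w" for w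
      using False by (simp_all add: scale_scale flip: of_real_mult abs_mult)
    ultimately show "rscale \<bar>c\<bar> (absv v) \<preceq> absv (rscale c v)"
      by (simp only:)
  qed
qed

text \<open>For self-adjoint \<open>v\<close> both diagonal entries in \<open>absv_sa\<close> equal
  \<open>absv v\<close>; compressing by the columns (1, 1) and (1, -1) gives twice the two
  elements.\<close>

lemma absv_ge:
  assumes "star v = v"
  shows "absv v + v \<in> Pos" "absv v - v \<in> Pos"
proof -
  let ?n = "order v"
  have "IF ?n \<triangleright> absv v \<triangleleft> IF ?n = absv v" by (simp add: IF_fix order_absv)
  then have P: "absv v + rscale (c\<^sup>2) (absv v) + rscale c (v + v) \<in> Pos" for c
    using pair_sa_column[OF absv_sa, of v c] assms by (simp add: order_fix)
  have two: "scale 2 u = u + u" for u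
    using scale_add_left[of 1 1 u] by simp
  have "rscale 2 (absv v + v) \<in> Pos" "rscale 2 (absv v - v) \<in> Pos"
    using P[of 1] P[of "- 1"] by (simp_all add: scale_minus_left two algebra_simps)
  then show "absv v + v \<in> Pos" "absv v - v \<in> Pos"
    using Pos_scale_cancel[of 2] by simp_all
qed

text \<open>Adding \<open>u - v\<close> to \<open>absv (u - v)\<close> or subtracting it gives
  \<open>2 u\<close> and \<open>2 v\<close>. The matrix axioms on orthogonality start from
  self-adjoint elements, those of the module from positive ones; this closes the gap.\<close>

lemma orthogonal_Pos:
  assumes "star u = u" "star v = v" "absv (u - v) = u + v"
  shows "u \<in> Pos" "v \<in> Pos"
proof -
  have two: "scale 2 u = u + u" for u
    using scale_add_left[of 1 1 u] by simp
  have "star (u - v) = u - v" by (simp add: star_diff assms)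
  from absv_ge[OF this] have "rscale 2 u \<in> Pos" "rscale 2 v \<in> Pos"
    by (simp_all add: assms two)
  then show "u \<in> Pos" "v \<in> Pos" using Pos_scale_cancel[of 2] by simp_all
qed

section \<open>Absolute values of matrices\<close>

definition absm :: "nat \<Rightarrow> nat \<Rightarrow> 'v mat \<Rightarrow> 'v mat" where
  "absm m n v = T_inv n n (absv (T_rect m n v))"

lemma absm_mem_M: "absm m n v \<in> mats.M n n"
  by (simp add: absm_def T_inv_mem)

text \<open>The cut-off to format \<open>n\<close> by \<open>n\<close> in \<open>T_inv n n\<close>
  loses nothing, even for \<open>m > n\<close>: by \<open>absv_supported\<close> the absolute value
  lives on the columns of its argument.\<close>

lemma T_rect_absm: "v \<in> mats.M m n \<Longrightarrow> T_rect n n (absm m n v) = absv (T_rect m n v)"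
  using absv_supported[of "{..<n}" "T_rect m n v"]
  by (simp add: absm_def T_rect_T_inv T_rect_fix flip: IF_eq_diagF)

lemma absm_mem_cone: "v \<in> mats.M m n \<Longrightarrow> absm m n v \<in> cone n"
  by (simp add: cone_def absm_mem_M T_rect_absm absv_Pos)

lemma absm_eq_iff:
  "v \<in> mats.M m n \<Longrightarrow> w \<in> mats.M n n \<Longrightarrow> absm m n v = w \<longleftrightarrow> absv (T_rect m n v) = T_rect n n w"
  using T_rect_inject[OF absm_mem_M, of w n m v] by (simp add: T_rect_absm)

lemma absolutely_ordered_level:
  assumes "n > 0"
  shows "absolutely_ordered_space (mats.M_sa n) (0\<^sub>m n n) mats.mscale (cone n) (absm n n)"
proof (intro absolutely_ordered_space.intro absolutely_ordered_space_axioms.intro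
    mats.ordered_level[OF assms])
  let ?T = "T_rect n n"
  have M: "v \<in> mats.M n n" "star (?T v) = ?T v" if "v \<in> mats.M_sa n" for v
    using that by (simp_all add: mats_M_sa_iff)
  have orth: "absm n n (u - v) = u + v \<longleftrightarrow> absv (?T u - ?T v) = ?T u + ?T v"
    if "u \<in> mats.M n n" "v \<in> mats.M n n" for u v
    using that by (simp add: absm_eq_iff mats_M_closed T_rect_add T_rect_diff)
  {
    fix v k assume "v \<in> mats.M_sa n"
    note v = M[OF this]
    show "absm n n v \<in> cone n" using v by (simp add: absm_mem_cone)
    show "absm n n v + v \<in> cone n" "absm n n v - v \<in> cone n"
      using v absv_ge[OF v(2)]
      by (simp_all add: cone_def absm_mem_M mats_M_closed T_rect_add T_rect_diff T_rect_absm)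
    show "absm n n (mats.mscale k v) = mats.mscale \<bar>k\<bar> (absm n n v)"
      using v by (simp add: absm_eq_iff absm_mem_M mats_M_closed T_rect_mscale T_rect_absm absv_scale)
  }
  show "absm n n v = v" if "v \<in> cone n" for v
    using that by (simp add: cone_def absm_eq_iff absv_of_Pos)
  fix u v w
  assume u: "u \<in> mats.M_sa n" and v: "v \<in> mats.M_sa n" and w: "w \<in> mats.M_sa n"
    and uv: "absm n n (u - v) = u + v"
  then have uv': "absv (?T u - ?T v) = ?T u + ?T v"
    by (simp add: orth M)
  note pos = orthogonal_Pos[OF M(2)[OF u] M(2)[OF v] uv']
  show "absm n n (u - w) = u + w" if "w \<in> cone n" "v - w \<in> cone n"
    using that absv_orth_le[OF pos _ uv', of "?T w"]
    by (simp add: orth M u v w cone_def le_def T_rect_diff)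
  assume uw: "absm n n (u - w) = u + w"
  then have uw': "absv (?T u - ?T w) = ?T u + ?T w"
    using u w by (simp add: orth M)
  note pos' = orthogonal_Pos(2)[OF M(2)[OF u] M(2)[OF w] uw']
  show "absm n n (u - absm n n (v + w)) = u + absm n n (v + w)"
    using absv_orth_add[OF pos pos' uv' uw']
    by (simp add: orth M u v w absm_mem_M T_rect_absm mats_M_closed T_rect_add)
  show "absm n n (u - absm n n (v - w)) = u + absm n n (v - w)"
    using absv_orth_diff[OF pos pos' uv' uw']
    by (simp add: orth M u v w absm_mem_M T_rect_absm mats_M_closed T_rect_diff)
qed

lemma absm_mul_mem_cone:
  assumes v: "v \<in> mats.M m n" and a: "a \<in> carrier_mat r m" and b: "b \<in> carrier_mat n s"
  shows "mats.mscale (opnorm a) (absm n s (mats.rmul (absm m n v) b))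
    - absm r s (mats.rmul (mats.lmul a v) b) \<in> cone s"
proof -
  have 1: "mats.rmul (absm m n v) b \<in> mats.M n s" by (rule mats_M_mul(2)[OF absm_mem_M b])
  have l: "mats.lmul a v \<in> mats.M r n" by (rule mats_M_mul(1)[OF v a])
  have 2: "mats.rmul (mats.lmul a v) b \<in> mats.M r s" by (rule mats_M_mul(2)[OF l b])
  show ?thesis
    using absv_act[of "finmat_of_mat a" "T_rect m n v" "finmat_of_mat b"]
    by (simp add: cone_def absm_mem_M mats_M_closed T_rect_diff T_rect_mscale T_rect_absm 1 2
        T_rect_rmul[OF absm_mem_M b] T_rect_rmul[OF l b] T_rect_lmul[OF v a] v
        normF_finmat_of_mat le_def)
qed

text \<open>In the module \<open>w\<close> is moved to rows and columns disjoint from those of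
  \<open>v\<close>, so the absolute value splits. The row shift disappears by
  \<open>absv_lact\<close>, and \<open>absv_ract\<close> turns the column shift into the conjugation
  that places the second diagonal block.\<close>

lemma absm_dsum:
  assumes v: "v \<in> mats.M m n" and w: "w \<in> mats.M r s"
  shows "absm (m + r) (n + s) (mats.dsum v w) = mats.dsum (absm m n v) (absm r s w)"
proof -
  let ?x = "T_rect m n v" and ?y = "T_rect r s w"
  let ?a = "adjF (shiftF m r)" and ?b = "shiftF n s"
  have x: "diagF {..<m} \<triangleright> ?x = ?x" "?x \<triangleleft> diagF {..<n} = ?x"
    and y: "diagF {..<r} \<triangleright> ?y = ?y" "?y \<triangleleft> diagF {..<s} = ?y"
    using T_rect_fix[OF v] T_rect_fix[OF w] by (simp_all add: IF_eq_diagF)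
  have "diagF {m..<m + r} * ?a = ?a" "?b * diagF {n..<n + s} = ?b"
    by (auto intro!: finmat_eqI simp: entry_diagF)
  then have y': "diagF {m..<m + r} \<triangleright> (?a \<triangleright> ?y \<triangleleft> ?b) = ?a \<triangleright> ?y \<triangleleft> ?b"
    "(?a \<triangleright> ?y \<triangleleft> ?b) \<triangleleft> diagF {n..<n + s} = ?a \<triangleright> ?y \<triangleleft> ?b"
    by (simp_all add: act_assocs)
  have "absv (?x + ?a \<triangleright> ?y \<triangleleft> ?b) = absv ?x + absv (?a \<triangleright> ?y \<triangleleft> ?b)"
    by (rule absv_add_disjoint[OF _ _ _ _ _ _ x y']) auto
  also have "absv (?a \<triangleright> ?y \<triangleleft> ?b) = absv (?a \<triangleright> (?y \<triangleleft> ?b))"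
    by (simp only: lact_ract)
  also have "\<dots> = absv (?y \<triangleleft> ?b)"
    by (rule absv_lact[of "{..<r}" "{m..<m + r}"])
      (simp_all add: shiftF_times_adjF_shiftF adjF_shiftF_times_shiftF y flip: lact_ract)
  also have "\<dots> = adjF ?b \<triangleright> absv ?y \<triangleleft> ?b"
    by (rule absv_ract[of "{..<s}" "{n..<n + s}"])
      (simp_all add: shiftF_times_adjF_shiftF adjF_shiftF_times_shiftF y)
  finally show ?thesis
    by (simp add: absm_eq_iff mats_M_dsum v w absm_mem_M T_rect_dsum T_rect_absm)
qed

lemma absolute_matrix_order_unit_space_corner:
  "absolute_matrix_order_unit_space corner scale star cone e absm"
proof -
  interpret amos: absolutely_matrix_ordered_space corner scale star cone absm
    by (intro absolutely_matrix_ordered_space.intro absolutely_matrix_ordered_space_axioms.intro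
        mats.matrix_ordered_space_axioms absm_mem_cone absolutely_ordered_level absm_mul_mem_cone
        absm_dsum)
  show ?thesis
  proof (intro absolute_matrix_order_unit_space.intro absolute_matrix_order_unit_space_axioms.intro
      mats.matrix_order_unit_space_axioms amos.absolutely_matrix_ordered_space_axioms)
    fix n u v assume n: "(n::nat) > 0" and u: "u \<in> cone n" and v: "v \<in> cone n"
    have "amos.mperp n u v \<longleftrightarrow> perp (T_rect n n u) (T_rect n n v)"
      using u v
      by (simp add: amos.mperp_def perp_def cone_def absm_eq_iff mats_M_closed T_rect_add T_rect_diff)
    also have "\<dots> \<longleftrightarrow> perp_inf_a (T_rect n n u) (T_rect n n v)"
      using u v by (intro perp_iff) (simp_all add: cone_def)
    also have "\<dots> \<longleftrightarrow> mats.mperp_inf_a n u v"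
      by (rule mats_mperp_inf_a[OF u v n, symmetric])
    finally show "amos.mperp n u v \<longleftrightarrow> mats.mperp_inf_a n u v" .
  qed
qed

section \<open>The result in terms of \<open>T\<close>\<close>

lemma inv_into_T: "w = T n v \<Longrightarrow> v \<in> mats.M n n \<Longrightarrow> inv_into (mats.M n n) (T n) w = v"
  by (auto simp: T_eq_T_rect T_rect_inject intro!: inv_into_f_f inj_onI)

text \<open>Compression by \<open>IF n\<close> fixes \<open>T n v\<close> and preserves
  \<open>Pos\<close>, so the preimage of the compressed cone is the preimage of \<open>Pos\<close>
  itself.\<close>

lemma cone_eq: "cone n = {v \<in> mats.M n n. T n v \<in> (\<lambda>w. IF n \<triangleright> w \<triangleleft> IF n) ` Pos}"
proof -
  have "T_rect n n v \<in> Pos \<longleftrightarrow> T_rect n n v \<in> (\<lambda>w. IF n \<triangleright> w \<triangleleft> IF n) ` Pos"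
    if v: "v \<in> mats.M n n" for v
  proof
    assume "T_rect n n v \<in> Pos"
    then show "T_rect n n v \<in> (\<lambda>w. IF n \<triangleright> w \<triangleleft> IF n) ` Pos"
      by (rule rev_image_eqI) (simp add: T_rect_fix v)
  next
    assume "T_rect n n v \<in> (\<lambda>w. IF n \<triangleright> w \<triangleleft> IF n) ` Pos"
    then show "T_rect n n v \<in> Pos" using Pos_conj[of _ "IF n"] by auto
  qed
  then show ?thesis by (auto simp: cone_def T_eq_T_rect)
qed

text \<open>The inverse of \<open>T 1\<close> yields a 1 by 1 matrix; its entry
  \<open>(0, 0)\<close> is the unit as an element of the corner, and it equals
  \<open>e\<close>.\<close>

lemma absolute_matrix_order_unit_space_T:
  "let M = (\<lambda>n. {v \<in> carrier_mat n n. elements_mat v \<subseteq> corner})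
   in \<exists>absm :: nat \<Rightarrow> nat \<Rightarrow> 'v mat \<Rightarrow> 'v mat.
        (\<forall>n>0. \<forall>v\<in>M n. absm n n v = inv_into (M n) (T n) (absv (T n v))) \<and>
        absolute_matrix_order_unit_space corner scale star
          (\<lambda>n. {v \<in> M n. T n v \<in> (\<lambda>w. IF n \<triangleright> w \<triangleleft> IF n) ` Pos})
          (inv_into (M 1) (T 1) e $$ (0, 0)) absm"
proof -
  have "T 1 (mat 1 1 (\<lambda>_. e)) = e"
    using unit_mem_corner by (simp add: T_def corner_iff)
  moreover have "mat 1 1 (\<lambda>_. e) \<in> mats.M 1 1"
    by (simp add: mats_M_iff unit_mem_corner)
  ultimately have "inv_into (mats.M 1 1) (T 1) e = mat 1 1 (\<lambda>_. e)"
    by (intro inv_into_T) simp_all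
  then have unit: "inv_into (mats.M 1 1) (T 1) e $$ (0, 0) = e"
    by simp
  have abs: "absm n n v = inv_into (mats.M n n) (T n) (absv (T n v))" if "v \<in> mats.M n n" for n v
    using that by (intro inv_into_T[symmetric]) (simp_all add: T_eq_T_rect T_rect_absm absm_mem_M)
  show ?thesis
    using abs absolute_matrix_order_unit_space_corner
    unfolding Let_def mats.M_def[symmetric] unit cone_eq[symmetric] by blast
qed

end

theorem corollary3p23:
  fixes lact :: "finmat \<Rightarrow> 'v::ab_group_add \<Rightarrow> 'v"
    and ract :: "'v \<Rightarrow> finmat \<Rightarrow> 'v"
    and star :: "'v \<Rightarrow> 'v"
    and Pos :: "'v set"
    and e :: 'v
    and absv :: "'v \<Rightarrow> 'v"
  assumes "nondegenerate_absolute_order_unital_F_bimodule lact ract star Pos e absv"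
  shows "let V = F_bimodule.corner lact ract;
             T = F_bimodule.T lact ract;
             M = (\<lambda>n. {v \<in> carrier_mat n n. elements_mat v \<subseteq> V})
         in \<exists>absm :: nat \<Rightarrow> nat \<Rightarrow> 'v mat \<Rightarrow> 'v mat.
              (\<forall>n>0. \<forall>v\<in>M n. absm n n v = inv_into (M n) (T n) (absv (T n v))) \<and>
              absolute_matrix_order_unit_space
                V (F_bimodule.scale lact ract) star
                (\<lambda>n. {v \<in> M n. T n v \<in> (\<lambda>w. ract (lact (IF n) w) (IF n)) ` Pos})
                (inv_into (M 1) (T 1) e $$ (0, 0))
                absm"
  using nondegenerate_absolute_order_unital_F_bimodule.absolute_matrix_order_unit_space_T[OF assms]
  unfolding Let_def .

end
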